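(* Let $X\in 2^\omega$. Then $\dim(X)=1$ if and only if there is a Martin-L\"of random sequence $Y\in 2^\omega$ such that $d(X,Y)=0$.
   Context: $2^\omega$ is the space of infinite binary sequences and $Z\upharpoonright_n$ is the $n$-bit prefix of $Z$. $K$ denotes prefix-free Kolmogorov complexity. The effective Hausdorff dimension of $X\in 2^\omega$ is $\dim(X)=\liminf_{n\to\infty} K(X\upharpoonright_n)/n$. A sequence $Y$ is Martin-L\"of random (with respect to the uniform measure) iff there is a constant $c$ with $K(Y\upharpoonright_n)\ge n-c$ for all $n$. For $n\ge 1$ and $\sigma,\tau\in\{0,1\}^n$, $d(\sigma,\tau)=\#\{k:\sigma(k)\ne\tau(k)\}/n$ is the normalised Hamming distance; for $X,Y\in 2^\omega$, $d(X,Y)=\limsup_{n\to\infty} d(X\upharpoonright_n,Y\upharpoonright_n)$. *)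

theory Defs
  imports Complex_Main "HOL-Library.Nat_Bijection" "HOL-Library.Sublist"
    "HOL-Library.Extended_Nat" "HOL-Library.Extended_Real"
begin

text \<open>Kleene's partial recursive functions, presented as unary functions on the naturals; several
  arguments are packed into one by the Cantor pairing function \<^const>\<open>prod_encode\<close>.
  \<^term>\<open>None\<close> means that the computation diverges.\<close>

text \<open>The value of the \<open>\<mu>\<close>-operator: the search converges to \<open>n\<close> only if \<open>f\<close> is also defined
  (and nonzero) at all earlier candidates.\<close>

definition mu_root :: "(nat \<rightharpoonup> nat) \<Rightarrow> nat \<Rightarrow> nat \<Rightarrow> bool" where
  "mu_root f a n \<longleftrightarrow>
     f (prod_encode (a, n)) = Some 0 \<and> (\<forall>m<n. \<exists>k. f (prod_encode (a, m)) = Some (Suc k))"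

inductive partial_recursive :: "(nat \<rightharpoonup> nat) \<Rightarrow> bool" where
  zero: "partial_recursive (\<lambda>n. Some 0)"
| succ: "partial_recursive (\<lambda>n. Some (Suc n))"
| left: "partial_recursive (\<lambda>n. Some (fst (prod_decode n)))"
| right: "partial_recursive (\<lambda>n. Some (snd (prod_decode n)))"
| pair: "partial_recursive f \<Longrightarrow> partial_recursive g \<Longrightarrow>
    partial_recursive (\<lambda>n. Option.bind (f n) (\<lambda>a. Option.bind (g n) (\<lambda>b. Some (prod_encode (a, b)))))"
| comp: "partial_recursive f \<Longrightarrow> partial_recursive g \<Longrightarrow>
    partial_recursive (\<lambda>n. Option.bind (g n) f)"
| prim_rec: "partial_recursive f \<Longrightarrow> partial_recursive g \<Longrightarrow>
    partial_recursive (\<lambda>n. case prod_decode n of (a, m) \<Rightarrow>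
      rec_nat (f a) (\<lambda>y r. Option.bind r (\<lambda>v. g (prod_encode (a, prod_encode (y, v))))) m)"
| mu: "partial_recursive f \<Longrightarrow>
    partial_recursive (\<lambda>a. if \<exists>n. mu_root f a n then Some (THE n. mu_root f a n) else None)"

definition code_string :: "bool list \<Rightarrow> nat" where
  "code_string \<sigma> = list_encode (map of_bool \<sigma>)"

definition partial_computable :: "(bool list \<rightharpoonup> bool list) \<Rightarrow> bool" where
  "partial_computable M \<longleftrightarrow>
     (\<exists>f. partial_recursive f \<and> (\<forall>\<sigma>. f (code_string \<sigma>) = map_option code_string (M \<sigma>)))"

definition prefix_free_machine :: "(bool list \<rightharpoonup> bool list) \<Rightarrow> bool" where
  "prefix_free_machine M \<longleftrightarrow>
     partial_computable M \<and> (\<forall>\<sigma>\<in>dom M. \<forall>\<tau>\<in>dom M. prefix \<sigma> \<tau> \<longrightarrow> \<sigma> = \<tau>)"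

text \<open>The length of a shortest description with respect to \<open>M\<close>; it is \<open>\<infinity>\<close> if there is none.\<close>

definition complexity :: "(bool list \<rightharpoonup> bool list) \<Rightarrow> bool list \<Rightarrow> enat" where
  "complexity M \<tau> = (INF \<sigma>\<in>{\<sigma>. M \<sigma> = Some \<tau>}. enat (length \<sigma>))"

text \<open>Prefix-free Kolmogorov complexity \<open>K\<close> is \<^term>\<open>complexity U\<close> for an optimal prefix-free
  machine \<open>U\<close>; by optimality, the choice of \<open>U\<close> changes it by at most an additive constant.\<close>

definition optimal_prefix_free_machine :: "(bool list \<rightharpoonup> bool list) \<Rightarrow> bool" where
  "optimal_prefix_free_machine U \<longleftrightarrow>
     prefix_free_machine U \<and>
     (\<forall>M. prefix_free_machine M \<longrightarrow>
        (\<exists>c::nat. \<forall>\<tau>. complexity U \<tau> \<le> complexity M \<tau> + enat c))"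

definition seq_prefix :: "(nat \<Rightarrow> bool) \<Rightarrow> nat \<Rightarrow> bool list" where
  "seq_prefix X n = map X [0..<n]"

definition effective_dim :: "(bool list \<rightharpoonup> bool list) \<Rightarrow> (nat \<Rightarrow> bool) \<Rightarrow> ereal" where
  "effective_dim U X =
     liminf (\<lambda>n. ereal_of_enat (complexity U (seq_prefix X n)) / ereal (real n))"

text \<open>The inequality \<open>K(Y\<restriction>n) \<ge> n - c\<close> is written without subtraction.\<close>

definition martin_loef_random :: "(bool list \<rightharpoonup> bool list) \<Rightarrow> (nat \<Rightarrow> bool) \<Rightarrow> bool" where
  "martin_loef_random U Y \<longleftrightarrow>
     (\<exists>c::nat. \<forall>n. enat n \<le> complexity U (seq_prefix Y n) + enat c)"

text \<open>Only meant for strings of equal length.\<close>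

definition hamming_dist :: "bool list \<Rightarrow> bool list \<Rightarrow> real" where
  "hamming_dist \<sigma> \<tau> = real (card {k. k < length \<sigma> \<and> \<sigma> ! k \<noteq> \<tau> ! k}) / real (length \<sigma>)"

definition seq_dist :: "(nat \<Rightarrow> bool) \<Rightarrow> (nat \<Rightarrow> bool) \<Rightarrow> ereal" where
  "seq_dist X Y = limsup (\<lambda>n. ereal (hamming_dist (seq_prefix X n) (seq_prefix Y n)))"

end

theory Submission imports Defs begin

text \<open>All complexity bounds come from one principle, \<open>complexity_le_log_card\<close>: if a finite set can be
enumerated from a parameter \<open>p\<close>, then each of its elements is described by \<open>p\<close> and its position in the
enumeration, so its complexity is at most the length of \<open>p\<close> plus the logarithm of the size of the set,
up to a sublinear term.

\<^emph>\<open>A sequence close to a random one has dimension one.\<close> If \<open>d(X, Y) = 0\<close>, then the prefix of \<open>Y\<close> of length \<open>n\<close>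
lies in a Hamming ball around the prefix of \<open>X\<close> whose radius is a small fraction of \<open>n\<close>. Such a ball has
\<open>2\<^sup>\<epsilon>\<^sup>n\<close> elements with \<open>\<epsilon>\<close> small (\<open>card_hamming_ball\<close>) and can be enumerated from a program for the prefix
of \<open>X\<close>. So the complexity of the prefix of \<open>X\<close> is at most a sublinear amount below that of the prefix of \<open>Y\<close>,
which is \<open>n - O(1)\<close>.

\<^emph>\<open>A sequence of dimension one is close to a random one.\<close> Let \<open>P\<close> be the class of all sequences without
compressible prefix. By Kraft's inequality \<open>P\<close> has measure at least \<open>1/2\<close>, and its elements are random.
Cut the positions into blocks, each about \<open>1/k\<close> times as long as everything before it, where \<open>k\<close> grows
slowly; the task is to find \<open>Y\<close> in \<open>P\<close> that differs from \<open>X\<close> on at most a fraction \<open>1/k\<close> of each block. After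
\<open>j\<close> blocks there is a candidate: a string \<open>y\<close> that satisfies all the distance conditions so far and has
the property that \<open>P\<close> has measure at least \<open>2\<^sup>-\<^sup>j\<^sup>-\<^sup>1\<close> relative to the cylinder of \<open>y\<close>. At least one in \<open>2\<^sup>j\<^sup>+\<^sup>2\<close>
of the possible next blocks keeps half of that measure (\<open>good_extensions\<close>), so by concentration of
measure on the Hamming cube only an exponentially small fraction of all blocks is far from all of these
(\<open>card_far_from_large_set\<close>).

Suppose that the next block of \<open>X\<close> could not be approached from any candidate. The set of blocks that are
unapproachable from \<^emph>\<open>every\<close> candidate can be enumerated from the prefix of \<open>X\<close> alone, because \<open>P\<close> is
co-enumerable, and it is exponentially small, because it is contained in the exceptional set of any one
candidate. Hence the prefix of \<open>X\<close> that ends with this block would be compressible by a constant factor,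
which dimension one excludes from some length on. The quantification over all candidates is the decisive
point: no candidate has to be described, so the errors of the earlier blocks do not accumulate.

How fast \<open>k\<close> may grow depends on the rate at which the complexity of \<open>X\<close> approaches its maximum. The
schedule is therefore not computable from the length; it becomes a part of the description, at the cost of
one bit per block. The candidates form an infinite finitely branching tree, and any infinite path through it is
the desired \<open>Y\<close> (\<open>ex_close_random_if_effective_dim_eq_1\<close>).\<close>

section \<open>Computable functions on coded types\<close>

text \<open>Types whose elements are coded by numbers, so that computability can be stated for functions between
them. Existential quantifiers over a type are turned into unbounded searches over codes, which need a
decoding function that is computable and total.\<close>

class coded = fixes enc :: "'a \<Rightarrow> nat" assumes enc_eq_iff [simp]: "enc x = enc y \<longleftrightarrow> x = y"

class decodable = coded + fixes dec :: "nat \<Rightarrow> 'a"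
  assumes dec_enc [simp]: "dec (enc x) = x"
    and partial_recursive_enc_dec: "partial_recursive (\<lambda>n. Some (enc (dec n)))"

abbreviation total_recursive :: "(nat \<Rightarrow> nat) \<Rightarrow> bool" where
  "total_recursive g \<equiv> partial_recursive (\<lambda>n. Some (g n))"

lemma total_recursive_pair:
  "total_recursive f \<Longrightarrow> total_recursive g \<Longrightarrow> total_recursive (\<lambda>n. prod_encode (f n, g n))"
  using partial_recursive.pair[of "\<lambda>n. Some (f n)" "\<lambda>n. Some (g n)"] by simp

lemma total_recursive_comp:
  "total_recursive f \<Longrightarrow> total_recursive g \<Longrightarrow> total_recursive (\<lambda>n. f (g n))"
  using partial_recursive.comp[of "\<lambda>n. Some (f n)" "\<lambda>n. Some (g n)"] by simp

lemma total_recursive_id: "total_recursive (\<lambda>n. n)"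
  using total_recursive_pair[OF partial_recursive.left partial_recursive.right] by simp

lemma total_recursive_const: "total_recursive (\<lambda>n. c)"
  by (induction c) (auto intro: partial_recursive.zero total_recursive_comp[OF partial_recursive.succ])

text \<open>Primitive recursion in which the step function may use the entire input \<open>n\<close>; the number of steps is
itself computed from \<open>n\<close>.\<close>

lemma total_recursive_rec_nat:
  assumes f: "total_recursive f" and g: "total_recursive g" and h: "total_recursive h"
  shows "total_recursive (\<lambda>n. rec_nat (f n) (\<lambda>y r. g (prod_encode (n, prod_encode (y, r)))) (h n))"
proof -
  have eq: "rec_nat (Some (f a)) (\<lambda>y r. Option.bind r (\<lambda>v. Some (g (prod_encode (a, prod_encode (y, v)))))) m
      = Some (rec_nat (f a) (\<lambda>y r. g (prod_encode (a, prod_encode (y, r)))) m)" for a m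
    by (induction m) auto
  have "total_recursive (\<lambda>n. case prod_decode n of (a, m) \<Rightarrow>
      rec_nat (f a) (\<lambda>y r. g (prod_encode (a, prod_encode (y, r)))) m)"
    using partial_recursive.prim_rec[OF f g] by (simp add: eq case_prod_beta)
  from total_recursive_comp[OF this total_recursive_pair[OF total_recursive_id h]]
  show ?thesis by simp
qed

lemma total_recursive_case_nat:
  assumes "total_recursive f"
  shows "total_recursive (\<lambda>n. case n of 0 \<Rightarrow> c | Suc m \<Rightarrow> f m)"
proof -
  have "total_recursive (\<lambda>n. fst (prod_decode (snd (prod_decode n))))"
    by (rule total_recursive_comp[OF partial_recursive.left partial_recursive.right])
  from total_recursive_rec_nat[OF total_recursive_const[of c]
      total_recursive_comp[OF assms this] total_recursive_id]
  have "total_recursive (\<lambda>n. rec_nat c (\<lambda>y r. f y) n)" by simp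
  moreover have "rec_nat c (\<lambda>y r. f y) n = (case n of 0 \<Rightarrow> c | Suc m \<Rightarrow> f m)" for n
    by (cases n) auto
  ultimately show ?thesis by simp
qed

definition computable :: "('a::coded \<Rightarrow> 'b::coded) \<Rightarrow> bool" where
  "computable f \<longleftrightarrow> (\<exists>g. total_recursive g \<and> (\<forall>x. g (enc x) = enc (f x)))"

lemma computableI: "total_recursive g \<Longrightarrow> (\<And>x. g (enc x) = enc (f x)) \<Longrightarrow> computable f"
  unfolding computable_def by blast

lemma computableE:
  assumes "computable f" obtains g where "total_recursive g" "\<And>x. g (enc x) = enc (f x)"
  using assms unfolding computable_def by blast

lemma computable_id: "computable (\<lambda>x. x)"
  by (rule computableI[OF total_recursive_id]) simp

lemma computable_const: "computable (\<lambda>x. c)"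
  by (rule computableI[OF total_recursive_const]) simp

lemma computable_comp: "computable f \<Longrightarrow> computable g \<Longrightarrow> computable (\<lambda>x. f (g x))"
proof -
  assume "computable f" "computable g"
  then obtain F G where "total_recursive F" "\<And>x. F (enc x) = enc (f x)"
    "total_recursive G" "\<And>x. G (enc x) = enc (g x)" unfolding computable_def by metis
  thus ?thesis by (intro computableI[OF total_recursive_comp[of F G]]) auto
qed

instantiation nat :: decodable begin
definition "enc (n::nat) = n"
definition "dec n = (n::nat)"
instance by standard (simp_all add: enc_nat_def dec_nat_def total_recursive_id)
end

instantiation bool :: decodable begin
definition "enc (b::bool) = of_bool b"
definition "dec (n::nat) = (n \<noteq> 0)"
instance proof
  have "total_recursive (\<lambda>n. case n of 0 \<Rightarrow> 0 | Suc m \<Rightarrow> 1)"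
    by (rule total_recursive_case_nat[OF total_recursive_const])
  moreover have "(case n of 0 \<Rightarrow> 0 | Suc m \<Rightarrow> 1) = enc (dec n :: bool)" for n
    by (auto simp: enc_bool_def dec_bool_def split: nat.split)
  ultimately show "total_recursive (\<lambda>n. enc (dec n :: bool))" by simp
qed (auto simp: enc_bool_def dec_bool_def)
end

instantiation prod :: (coded, coded) coded begin
definition "enc p = prod_encode (enc (fst p), enc (snd p))"
instance by standard (auto simp: enc_prod_def prod_eq_iff)
end

instantiation prod :: (decodable, decodable) decodable begin
definition "dec n = (dec (fst (prod_decode n)), dec (snd (prod_decode n)))"
instance proof
  show "total_recursive (\<lambda>n. enc (dec n :: 'a \<times> 'b))"
    unfolding enc_prod_def dec_prod_def fst_conv snd_conv
    by (intro total_recursive_pair total_recursive_comp[OF partial_recursive_enc_dec]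
        partial_recursive.left partial_recursive.right)
qed (auto simp: enc_prod_def dec_prod_def)
end

instantiation list :: (coded) coded begin
definition "enc xs = list_encode (map enc xs)"
instance by standard (simp add: enc_list_def list_encode_eq inj_map_eq_map inj_def)
end

lemma enc_Nil [simp]: "enc [] = 0"
  and enc_Cons [simp]: "enc (x # xs) = Suc (prod_encode (enc x, enc xs))"
  by (simp_all add: enc_list_def)

lemma length_le_enc: "length xs \<le> enc xs"
proof (induction xs)
  case (Cons x xs)
  then show ?case using le_prod_encode_2[of "enc xs" "enc x"] by simp
qed simp

lemma code_string_eq_enc: "code_string \<sigma> = enc \<sigma>"
  by (simp add: code_string_def enc_list_def enc_bool_def[abs_def])

lemma computable_Pair: "computable f \<Longrightarrow> computable g \<Longrightarrow> computable (\<lambda>x. (f x, g x))"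
proof -
  assume "computable f" "computable g"
  then obtain F G where "total_recursive F" "\<And>x. F (enc x) = enc (f x)"
    "total_recursive G" "\<And>x. G (enc x) = enc (g x)" unfolding computable_def by metis
  thus ?thesis by (intro computableI[OF total_recursive_pair[of F G]]) (auto simp: enc_prod_def)
qed

lemma computable_fst: "computable f \<Longrightarrow> computable (\<lambda>x. fst (f x))"
  by (elim computableE)
     (rule computableI[OF total_recursive_comp[OF partial_recursive.left]], auto simp: enc_prod_def)

lemma computable_snd: "computable f \<Longrightarrow> computable (\<lambda>x. snd (f x))"
  by (elim computableE)
     (rule computableI[OF total_recursive_comp[OF partial_recursive.right]], auto simp: enc_prod_def)

lemma computable_Suc: "computable f \<Longrightarrow> computable (\<lambda>x. Suc (f x))"
  by (elim computableE)
     (rule computableI[OF total_recursive_comp[OF partial_recursive.succ]], auto simp: enc_nat_def)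

lemma computable_enc: "computable f \<Longrightarrow> computable (\<lambda>x. enc (f x))"
  by (elim computableE) (rule computableI, auto simp: enc_nat_def)

lemma computable_dec: "computable f \<Longrightarrow> computable (\<lambda>x. dec (f x))"
  by (elim computableE)
     (rule computableI[OF total_recursive_comp[OF partial_recursive_enc_dec]], auto simp: enc_nat_def)

lemma computable_prod_decode: "computable f \<Longrightarrow> computable (\<lambda>x. prod_decode (f x))"
  by (elim computableE) (rule computableI, auto simp: enc_nat_def enc_prod_def)

lemma computable_prod_encode: "computable f \<Longrightarrow> computable (\<lambda>x. prod_encode (f x))"
  by (elim computableE) (rule computableI, auto simp: enc_nat_def enc_prod_def)

lemma computable_of_bool: "computable f \<Longrightarrow> computable (\<lambda>x. of_bool (f x) :: nat)"
  by (elim computableE) (rule computableI, auto simp: enc_nat_def enc_bool_def)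

text \<open>The closure lemmas have the shape of introduction rules for an arbitrary context \<open>x\<close>. A bound variable
becomes an additional component of the context.\<close>

lemma computable_rec_nat:
  assumes "computable f" "computable (\<lambda>z. g (fst z) (fst (snd z)) (snd (snd z)))" "computable h"
  shows "computable (\<lambda>x. rec_nat (f x) (\<lambda>y r. g x y r) (h x))"
proof -
  obtain F where F: "total_recursive F" "\<And>x. F (enc x) = enc (f x)" using assms(1) unfolding computable_def by blast
  obtain G where G: "total_recursive G"
    "\<And>z. G (enc z) = enc (g (fst z) (fst (snd z)) (snd (snd z)))" using assms(2) unfolding computable_def by blast
  obtain H where H: "total_recursive H" "\<And>x. H (enc x) = enc (h x)" using assms(3) unfolding computable_def by blast
  have G': "G (prod_encode (enc x, prod_encode (y, enc r))) = enc (g x y r)" for x y r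
    using G(2)[of "(x, y, r)"] by (simp add: enc_prod_def enc_nat_def)
  have "rec_nat (F (enc x)) (\<lambda>y r. G (prod_encode (enc x, prod_encode (y, r)))) n
      = enc (rec_nat (f x) (\<lambda>y r. g x y r) n)" for x n
    by (induction n) (simp_all add: F G')
  thus ?thesis
    by (intro computableI[OF total_recursive_rec_nat[OF F(1) G(1) H(1)]]) (simp add: H enc_nat_def)
qed

lemma computable_if:
  assumes "computable P" "computable f" "computable g"
  shows "computable (\<lambda>x. if P x then f x else g x)"
proof -
  have "computable (\<lambda>x. rec_nat (g x) (\<lambda>y r. f x) (of_bool (P x)))"
    by (intro computable_rec_nat computable_of_bool assms computable_comp[OF assms(2)]
        computable_fst computable_id)
  moreover have "rec_nat (g x) (\<lambda>y r. f x) (of_bool (P x)) = (if P x then f x else g x)" for x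
    by simp
  ultimately show ?thesis by simp
qed

lemma computable_eq_0:
  assumes "computable f" shows "computable (\<lambda>x. f x = (0::nat))"
proof -
  have "computable (\<lambda>n. n = (0::nat))"
    by (rule computableI[OF total_recursive_case_nat[OF total_recursive_const[of 0], of 1]])
       (auto simp: enc_nat_def enc_bool_def split: nat.split)
  from computable_comp[OF this assms] show ?thesis .
qed

lemma computable_not: "computable P \<Longrightarrow> computable (\<lambda>x. \<not> P x)"
  using computable_if[of P "\<lambda>x. False" "\<lambda>x. True"] by (simp add: computable_const if_bool_eq_conj)

lemma computable_conj: "computable P \<Longrightarrow> computable Q \<Longrightarrow> computable (\<lambda>x. P x \<and> Q x)"
  using computable_if[of P Q "\<lambda>x. False"] by (simp add: computable_const if_bool_eq_disj)

lemma computable_disj: "computable P \<Longrightarrow> computable Q \<Longrightarrow> computable (\<lambda>x. P x \<or> Q x)"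
  using computable_not[OF computable_conj[OF computable_not computable_not], of P Q] by simp

lemma computable_imp: "computable P \<Longrightarrow> computable Q \<Longrightarrow> computable (\<lambda>x. P x \<longrightarrow> Q x)"
  using computable_disj[OF computable_not, of P Q] by simp

lemma computable_add:
  assumes "computable f" "computable g" shows "computable (\<lambda>x. f x + g x :: nat)"
proof -
  have "computable (\<lambda>x. rec_nat (f x) (\<lambda>y r. Suc r) (g x))"
    by (intro computable_rec_nat assms computable_Suc computable_snd computable_id)
  moreover have "rec_nat a (\<lambda>y r. Suc r) b = a + b" for a b by (induction b) auto
  ultimately show ?thesis by simp
qed

lemma computable_mult:
  assumes "computable f" "computable g" shows "computable (\<lambda>x. f x * g x :: nat)"
proof -
  have "computable (\<lambda>x. rec_nat 0 (\<lambda>y r. r + f x) (g x))"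
    by (intro computable_rec_nat assms computable_add computable_snd computable_id computable_const
        computable_comp[OF assms(1)] computable_fst)
  moreover have "rec_nat 0 (\<lambda>y r. r + a) b = a * b" for a b :: nat by (induction b) auto
  ultimately show ?thesis by simp
qed

lemma computable_diff:
  assumes "computable f" "computable g" shows "computable (\<lambda>x. f x - g x :: nat)"
proof -
  have "computable (\<lambda>n::nat. rec_nat 0 (\<lambda>y r. y) n)"
    by (intro computable_rec_nat computable_fst computable_snd computable_id computable_const)
  moreover have "rec_nat 0 (\<lambda>y r. y) n = n - 1" for n by (cases n) auto
  ultimately have pred: "computable (\<lambda>n::nat. n - 1)" by simp
  have "computable (\<lambda>x. rec_nat (f x) (\<lambda>y r. r - 1) (g x))"
    by (intro computable_rec_nat assms computable_comp[OF pred] computable_snd computable_id)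
  moreover have "rec_nat a (\<lambda>y r. r - 1) b = a - b" for a b by (induction b) auto
  ultimately show ?thesis by simp
qed

lemma computable_le: "computable f \<Longrightarrow> computable g \<Longrightarrow> computable (\<lambda>x. f x \<le> (g x :: nat))"
  using computable_eq_0[OF computable_diff, of f g] by simp

lemma computable_less: "computable f \<Longrightarrow> computable g \<Longrightarrow> computable (\<lambda>x. f x < (g x :: nat))"
  using computable_le[OF computable_Suc, of f g] by (simp add: Suc_le_eq)

lemma computable_eq:
  fixes f g :: "'a::coded \<Rightarrow> 'b::coded"
  assumes "computable f" "computable g" shows "computable (\<lambda>x. f x = g x)"
proof -
  have "computable (\<lambda>x. enc (f x) \<le> enc (g x) \<and> enc (g x) \<le> enc (f x))"
    by (intro computable_conj computable_le computable_enc assms)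
  moreover have "enc (f x) \<le> enc (g x) \<and> enc (g x) \<le> enc (f x) \<longleftrightarrow> f x = g x" for x
    using enc_eq_iff[of "f x" "g x"] by auto
  ultimately show ?thesis by simp
qed

lemma computable_power:
  assumes "computable f" "computable g" shows "computable (\<lambda>x. f x ^ g x :: nat)"
proof -
  have "computable (\<lambda>x. rec_nat 1 (\<lambda>y r. r * f x) (g x))"
    by (intro computable_rec_nat assms computable_mult computable_snd computable_id computable_const
        computable_comp[OF assms(1)] computable_fst)
  moreover have "rec_nat 1 (\<lambda>y r. r * a) b = a ^ b" for a b :: nat by (induction b) auto
  ultimately show ?thesis by simp
qed

text \<open>The quotient is the last \<open>i\<close> at most the dividend for which \<open>i\<close> times the divisor does not exceed the
dividend; the loop remembers the latest such \<open>i\<close>.\<close>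

lemma computable_div:
  assumes f: "computable f" and g: "computable g" shows "computable (\<lambda>x. f x div g x :: nat)"
proof -
  have "computable (\<lambda>x. if g x = 0 then 0 else rec_nat 0 (\<lambda>i r. if Suc i * g x \<le> f x then Suc i else r) (f x))"
    by (intro computable_rec_nat computable_if computable_le computable_eq computable_mult computable_Suc assms
        computable_snd computable_id computable_const computable_comp[OF f] computable_comp[OF g] computable_fst)
  moreover have "rec_nat 0 (\<lambda>i r. if Suc i * b \<le> a then Suc i else r) n = min n (a div b)" if "b > 0" for a b n :: nat
  proof (induction n)
    case (Suc n)
    have "Suc n * b \<le> a \<longleftrightarrow> Suc n \<le> a div b" using that by (simp add: less_eq_div_iff_mult_less_eq)
    then show ?case using Suc by auto
  qed simp
  hence "(if b = 0 then 0 else rec_nat 0 (\<lambda>i r. if Suc i * b \<le> a then Suc i else r) a) = a div b" for a b :: nat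
    by simp
  ultimately show ?thesis by simp
qed

lemma computable_Cons: "computable f \<Longrightarrow> computable g \<Longrightarrow> computable (\<lambda>x. f x # g x)"
proof -
  assume "computable f" "computable g"
  then obtain F G where "total_recursive F" "\<And>x. F (enc x) = enc (f x)"
    "total_recursive G" "\<And>x. G (enc x) = enc (g x)" unfolding computable_def by metis
  thus ?thesis
    by (intro computableI[OF total_recursive_comp[OF partial_recursive.succ total_recursive_pair[of F G]]]) auto
qed

lemma computable_hd:
  assumes "computable f" shows "computable (\<lambda>x. hd (f x))"
proof -
  have "computable (hd :: 'b list \<Rightarrow> _)"
  proof (rule computableI[OF total_recursive_case_nat[OF partial_recursive.left, of "enc (hd [] :: 'b)"]])
    fix xs :: "'b list"
    show "(case enc xs of 0 \<Rightarrow> enc (hd [] :: 'b) | Suc m \<Rightarrow> fst (prod_decode m)) = enc (hd xs)"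
      by (cases xs) auto
  qed
  from computable_comp[OF this assms] show ?thesis .
qed

lemma computable_tl:
  assumes "computable f" shows "computable (\<lambda>x. tl (f x))"
proof -
  have "computable (tl :: 'b list \<Rightarrow> _)"
  proof (rule computableI[OF total_recursive_case_nat[OF partial_recursive.right, of 0]])
    fix xs :: "'b list"
    show "(case enc xs of 0 \<Rightarrow> 0 | Suc m \<Rightarrow> snd (prod_decode m)) = enc (tl xs)"
      by (cases xs) auto
  qed
  from computable_comp[OF this assms] show ?thesis .
qed

lemmas computable_base = computable_id computable_const computable_fst computable_snd computable_Pair
  computable_Suc computable_enc computable_dec computable_prod_decode computable_prod_encode computable_of_bool
  computable_not computable_conj computable_disj computable_imp computable_add computable_mult computable_diff
  computable_le computable_less computable_eq computable_power computable_div computable_if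
  computable_Cons computable_hd computable_tl

lemma computable_drop:
  assumes "computable n" "computable f" shows "computable (\<lambda>x. drop (n x) (f x))"
proof -
  have "computable (\<lambda>x. rec_nat (f x) (\<lambda>y r. tl r) (n x))"
    by (intro computable_rec_nat assms computable_base)
  moreover have "rec_nat l (\<lambda>y r. tl r) m = drop m l" for l :: "'b list" and m
    by (induction m) (auto simp: drop_Suc tl_drop)
  ultimately show ?thesis by simp
qed

text \<open>The loop consumes the list from the front. The code of a list bounds its length, so as many
iterations as the code suffice, and the surplus ones do nothing.\<close>

lemma computable_fold:
  assumes g: "computable (\<lambda>z. g (fst z) (fst (snd z)) (snd (snd z)))"
    and l: "computable l" and a: "computable a"
  shows "computable (\<lambda>x. fold (\<lambda>e r. g x e r) (l x) (a x))"
proof -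
  have G: "computable (\<lambda>z. g (f1 z) (f2 z) (f3 z))"
    if "computable f1" "computable f2" "computable f3" for f1 f2 f3
    using computable_comp[OF g computable_Pair[OF that(1) computable_Pair[OF that(2,3)]]] by simp
  let ?st = "\<lambda>x s. if fst s = [] then s else (tl (fst s), g x (hd (fst s)) (snd s))"
  have "computable (\<lambda>x. snd (rec_nat (l x, a x) (\<lambda>y s. ?st x s) (enc (l x))))"
    by (intro computable_rec_nat computable_base l a G)
  \<comment> \<open>after \<open>n\<close> iterations the first \<open>n\<close> entries have been processed\<close>
  moreover have "rec_nat (xs, b) (\<lambda>y s. ?st x s) n = (drop n xs, fold (g x) (take n xs) b)" for x xs b n
  proof (induction n)
    case (Suc n)
    then show ?case
      by (cases "n < length xs") (auto simp: drop_Suc tl_drop hd_drop_conv_nth take_Suc_conv_app_nth)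
  qed simp
  ultimately show ?thesis by (simp add: length_le_enc)
qed

lemma computable_rev:
  assumes "computable f" shows "computable (\<lambda>x. rev (f x))"
proof -
  have "computable (\<lambda>x. fold (\<lambda>e r. e # r) (f x) [])"
    by (intro computable_fold computable_base assms)
  thus ?thesis by (simp add: fold_Cons_rev)
qed

lemma computable_foldr:
  assumes "computable (\<lambda>z. g (fst z) (fst (snd z)) (snd (snd z)))" "computable l" "computable a"
  shows "computable (\<lambda>x. foldr (\<lambda>e r. g x e r) (l x) (a x))"
  unfolding foldr_conv_fold by (intro computable_fold computable_rev assms)

lemma computable_length:
  assumes "computable l" shows "computable (\<lambda>x. length (l x))"
proof -
  have "computable (\<lambda>x. foldr (\<lambda>e r. Suc r) (l x) 0)"
    by (intro computable_foldr computable_base assms)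
  moreover have "foldr (\<lambda>e r. Suc r) xs 0 = length xs" for xs :: "'b list" by (induction xs) auto
  ultimately show ?thesis by simp
qed

lemma computable_append:
  assumes "computable f" "computable g" shows "computable (\<lambda>x. f x @ g x)"
proof -
  have "computable (\<lambda>x. foldr (\<lambda>e r. e # r) (f x) (g x))"
    by (intro computable_foldr computable_base assms)
  moreover have "foldr (\<lambda>e r. e # r) xs ys = xs @ ys" for xs ys :: "'b list" by (induction xs) auto
  ultimately show ?thesis by simp
qed

lemma computable_map:
  assumes "computable (\<lambda>z. f (fst z) (snd z))" "computable l"
  shows "computable (\<lambda>x. map (\<lambda>y. f x y) (l x))"
proof -
  have "computable (\<lambda>x. foldr (\<lambda>e r. f x e # r) (l x) [])"
    by (intro computable_foldr computable_base assms
        computable_comp[OF assms(1), where g = "\<lambda>z. (fst z, fst (snd z))", simplified])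
  moreover have "foldr (\<lambda>e r. h e # r) xs [] = map h xs" for xs :: "'b list" and h :: "'b \<Rightarrow> 'c"
    by (induction xs) auto
  ultimately show ?thesis by simp
qed

lemma computable_filter:
  assumes "computable (\<lambda>z. P (fst z) (snd z))" "computable l"
  shows "computable (\<lambda>x. filter (\<lambda>y. P x y) (l x))"
proof -
  have "computable (\<lambda>x. foldr (\<lambda>e r. if P x e then e # r else r) (l x) [])"
    by (intro computable_foldr computable_base assms
        computable_comp[OF assms(1), where g = "\<lambda>z. (fst z, fst (snd z))", simplified])
  moreover have "foldr (\<lambda>e r. if h e then e # r else r) xs [] = filter h xs" for xs :: "'b list" and h
    by (induction xs) auto
  ultimately show ?thesis by simp
qed

lemma computable_ball:
  assumes "computable (\<lambda>z. P (fst z) (snd z))" "computable l"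
  shows "computable (\<lambda>x. \<forall>y\<in>set (l x). P x y)"
proof -
  have "computable (\<lambda>x. foldr (\<lambda>e r. P x e \<and> r) (l x) True)"
    by (intro computable_foldr computable_base assms
        computable_comp[OF assms(1), where g = "\<lambda>z. (fst z, fst (snd z))", simplified])
  moreover have "foldr (\<lambda>e r. h e \<and> r) xs True = (\<forall>y\<in>set xs. h y)" for xs :: "'b list" and h
    by (induction xs) auto
  ultimately show ?thesis by simp
qed

lemma computable_bex:
  assumes "computable (\<lambda>z. P (fst z) (snd z))" "computable l"
  shows "computable (\<lambda>x. \<exists>y\<in>set (l x). P x y)"
  using computable_not[OF computable_ball[OF computable_not[OF assms(1)] assms(2)]] by simp

lemma computable_upt:
  assumes "computable f" "computable g" shows "computable (\<lambda>x. [f x..<g x])"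
proof -
  have "computable (\<lambda>x. rec_nat [] (\<lambda>i r. if f x \<le> i then r @ [i] else r) (g x))"
    by (intro computable_rec_nat computable_append computable_base assms computable_comp[OF assms(1)])
  moreover have "rec_nat [] (\<lambda>i r. if m \<le> i then r @ [i] else r) n = [m..<n]" for m n
    by (induction n) auto
  ultimately show ?thesis by simp
qed

lemma computable_replicate:
  assumes "computable n" "computable f" shows "computable (\<lambda>x. replicate (n x) (f x))"
proof -
  have "computable (\<lambda>x. rec_nat [] (\<lambda>i r. f x # r) (n x))"
    by (intro computable_rec_nat computable_base assms computable_comp[OF assms(2)])
  moreover have "rec_nat [] (\<lambda>i r. e # r) m = replicate m e" for m and e :: 'b
    by (induction m) auto
  ultimately show ?thesis by simp
qed

lemma computable_concat:
  assumes "computable f" shows "computable (\<lambda>x. concat (f x))"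
proof -
  have "computable (\<lambda>x. foldr (\<lambda>e r. e @ r) (f x) [])"
    by (intro computable_foldr computable_append computable_base assms)
  thus ?thesis by (simp add: concat_conv_foldr)
qed

lemma computable_n_lists:
  assumes "computable n" "computable f" shows "computable (\<lambda>x. List.n_lists (n x) (f x))"
proof -
  have "computable (\<lambda>x. rec_nat [[]] (\<lambda>i r. concat (map (\<lambda>ys. map (\<lambda>y. y # ys) (f x)) r)) (n x))"
    by (intro computable_rec_nat computable_concat computable_map computable_base assms computable_comp[OF assms(2)])
  moreover have "rec_nat [[]] (\<lambda>i r. concat (map (\<lambda>ys. map (\<lambda>y. y # ys) l) r)) m = List.n_lists m l" for m and l :: "'b list"
    by (induction m) auto
  ultimately show ?thesis by simp
qed

text \<open>The fold carries along the part of the list that it has already seen.\<close>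

lemma computable_distinct:
  assumes "computable f" shows "computable (\<lambda>x. distinct (f x))"
proof -
  have "computable (\<lambda>x. snd (foldr (\<lambda>e s. (e # fst s, (\<forall>y\<in>set (fst s). y \<noteq> e) \<and> snd s)) (f x) ([], True)))"
    by (intro computable_foldr computable_ball computable_base assms)
  moreover have "foldr (\<lambda>e s. (e # fst s, (\<forall>y\<in>set (fst s). y \<noteq> e) \<and> snd s)) xs ([], True) = (xs, distinct xs)"
    for xs :: "'b list" by (induction xs) auto
  ultimately show ?thesis by simp
qed

lemma computable_horner_sum:
  assumes "computable f" shows "computable (\<lambda>x. horner_sum of_bool (2::nat) (f x))"
proof -
  have "computable (\<lambda>x. foldr (\<lambda>e r. of_bool e + 2 * r) (f x) (0::nat))"
    by (intro computable_foldr computable_base assms)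
  thus ?thesis by (simp add: horner_sum_foldr comp_def)
qed

lemmas computable_intros = computable_base computable_drop computable_length computable_append
  computable_map computable_filter computable_ball computable_bex computable_upt computable_replicate
  computable_concat computable_n_lists computable_distinct computable_horner_sum

instantiation list :: (decodable) decodable begin
definition "dec n = map dec (list_decode n)"
instance proof
  have "computable (\<lambda>xs::nat list. map (\<lambda>y. enc (dec y :: 'a)) xs)"
    by (intro computable_intros)
  then obtain g where g: "total_recursive g"
    "\<And>xs::nat list. g (enc xs) = enc (map (\<lambda>y. enc (dec y :: 'a)) xs)" unfolding computable_def by blast
  have "g n = enc (dec n :: 'a list)" for n
    using g(2)[of "list_decode n"] by (simp add: enc_list_def dec_list_def enc_nat_def[abs_def] comp_def)
  thus "total_recursive (\<lambda>n. enc (dec n :: 'a list))" using g(1) by simp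
qed (simp add: enc_list_def dec_list_def comp_def)
end

section \<open>Computably enumerable predicates\<close>

definition ce :: "('a::coded \<Rightarrow> bool) \<Rightarrow> bool" where
  "ce P \<longleftrightarrow> (\<exists>R. computable R \<and> (\<forall>x. P x \<longleftrightarrow> (\<exists>s::nat. R (x, s))))"

lemma ceE:
  assumes "ce P" obtains R where "computable R" "\<And>x. P x \<longleftrightarrow> (\<exists>s::nat. R (x, s))"
  using assms unfolding ce_def by blast

lemma ceI: "computable R \<Longrightarrow> (\<And>x. P x \<longleftrightarrow> (\<exists>s::nat. R (x, s))) \<Longrightarrow> ce P"
  unfolding ce_def by blast

lemma ce_computable: "computable P \<Longrightarrow> ce P"
  by (rule ceI[of "\<lambda>z. P (fst z)"]) (simp_all add: computable_comp[of P, OF _ computable_fst[OF computable_id]])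

lemma ce_comp:
  assumes "ce P" "computable f" shows "ce (\<lambda>x. P (f x))"
proof -
  obtain R where R0: "computable R" and RS: "\<And>x. P x \<longleftrightarrow> (\<exists>s::nat. R (x, s))"
    using ceE[OF assms(1)] by blast
  note R = computable_comp[OF R0 computable_Pair]
  show ?thesis
    by (rule ceI[of "\<lambda>z. R (f (fst z), snd z)"]) (intro R computable_comp[OF assms(2)] computable_intros, simp add: RS)
qed

text \<open>A witness for the conjunction codes a pair of witnesses.\<close>

lemma ce_conj:
  assumes "ce P" "ce Q" shows "ce (\<lambda>x. P x \<and> Q x)"
proof -
  obtain R where R0: "computable R" and RS: "\<And>x. P x \<longleftrightarrow> (\<exists>s::nat. R (x, s))"
    using ceE[OF assms(1)] by blast
  obtain S where S0: "computable S" and SS: "\<And>x. Q x \<longleftrightarrow> (\<exists>s::nat. S (x, s))"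
    using ceE[OF assms(2)] by blast
  note R = computable_comp[OF R0 computable_Pair]
  note S = computable_comp[OF S0 computable_Pair]
  show ?thesis
  proof (rule ceI[of "\<lambda>z. R (fst z, fst (prod_decode (snd z))) \<and> S (fst z, snd (prod_decode (snd z)))"])
    show "P x \<and> Q x \<longleftrightarrow> (\<exists>s. R (fst (x, s), fst (prod_decode (snd (x, s)))) \<and>
        S (fst (x, s), snd (prod_decode (snd (x, s)))))" for x
      unfolding RS SS by (metis fst_conv snd_conv prod_encode_inverse)
  qed (intro R S computable_intros)
qed

lemma ce_disj:
  assumes "ce P" "ce Q" shows "ce (\<lambda>x. P x \<or> Q x)"
proof -
  obtain R where R0: "computable R" and RS: "\<And>x. P x \<longleftrightarrow> (\<exists>s::nat. R (x, s))"
    using ceE[OF assms(1)] by blast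
  obtain S where S0: "computable S" and SS: "\<And>x. Q x \<longleftrightarrow> (\<exists>s::nat. S (x, s))"
    using ceE[OF assms(2)] by blast
  show ?thesis
    by (rule ceI[of "\<lambda>z. R z \<or> S z"]) (intro R0 S0 computable_intros, auto simp: RS SS)
qed

lemma ce_ex:
  fixes P :: "'a::coded \<Rightarrow> 'b::decodable \<Rightarrow> bool"
  assumes "ce (\<lambda>z. P (fst z) (snd z))" shows "ce (\<lambda>x. \<exists>y. P x y)"
proof -
  obtain R where R0: "computable R" and RS: "\<And>z. P (fst z) (snd z) \<longleftrightarrow> (\<exists>s::nat. R (z, s))"
    using ceE[OF assms] by blast
  note R = computable_comp[OF R0 computable_Pair]
  show ?thesis
  proof (rule ceI[of "\<lambda>z. R ((fst z, dec (fst (prod_decode (snd z)))), snd (prod_decode (snd z)))"])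
    fix x
    have "(\<exists>y. P x y) \<longleftrightarrow> (\<exists>y s. R ((x, y), s))" using RS[of "(x, _)"] by simp
    also have "\<dots> \<longleftrightarrow> (\<exists>s. R ((x, dec (fst (prod_decode s))), snd (prod_decode s)))"
      by (metis dec_enc fst_conv snd_conv prod_encode_inverse)
    finally show "(\<exists>y. P x y) \<longleftrightarrow>
      (\<exists>s. R ((fst (x, s), dec (fst (prod_decode (snd (x, s))))), snd (prod_decode (snd (x, s)))))" by simp
  qed (intro R computable_intros)
qed

text \<open>The finitely many instances have a common bound on their witnesses.\<close>

lemma ce_ball:
  assumes "ce (\<lambda>z. P (fst z) (snd z))" "computable l" shows "ce (\<lambda>x. \<forall>y\<in>set (l x). P x y)"
proof -
  obtain R where R0: "computable R" and RS: "\<And>z. P (fst z) (snd z) \<longleftrightarrow> (\<exists>s::nat. R (z, s))"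
    using ceE[OF assms(1)] by blast
  note R = computable_comp[OF R0 computable_Pair]
  show ?thesis
  proof (rule ceI[of "\<lambda>z. \<forall>y\<in>set (l (fst z)). \<exists>s\<in>set [0..<snd z]. R ((fst z, y), s)"])
    fix x
    have "(\<forall>y\<in>set (l x). P x y) \<longleftrightarrow> (\<exists>n. \<forall>y\<in>set (l x). \<exists>s\<in>set [0..<n]. R ((x, y), s))"
    proof
      assume "\<forall>y\<in>set (l x). P x y"
      hence "\<forall>y\<in>set (l x). \<exists>s. R ((x, y), s)" using RS[of "(x, _)"] by simp
      then obtain f where f: "\<And>y. y \<in> set (l x) \<Longrightarrow> R ((x, y), f y)" by metis
      have "f y < Suc (Max (f ` set (l x)))" if "y \<in> set (l x)" for y
        using that by (simp add: le_imp_less_Suc)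
      hence "\<forall>y\<in>set (l x). \<exists>s\<in>set [0..<Suc (Max (f ` set (l x)))]. R ((x, y), s)"
        using f by (metis atLeastLessThan_iff le0 set_upt)
      thus "\<exists>n. \<forall>y\<in>set (l x). \<exists>s\<in>set [0..<n]. R ((x, y), s)" ..
    next
      assume "\<exists>n. \<forall>y\<in>set (l x). \<exists>s\<in>set [0..<n]. R ((x, y), s)"
      thus "\<forall>y\<in>set (l x). P x y" using RS[of "(x, _)"] by auto
    qed
    thus "(\<forall>y\<in>set (l x). P x y) \<longleftrightarrow>
      (\<exists>n. \<forall>y\<in>set (l (fst (x, n))). \<exists>s\<in>set [0..<snd (x, n)]. R ((fst (x, n), y), s))" by simp
  qed (intro R computable_intros computable_comp[OF assms(2)])
qed

lemmas ce_intros = ce_conj ce_disj ce_ex ce_ball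

subsection \<open>Graphs of partial recursive functions\<close>

lemma mu_root_total:
  "mu_root (\<lambda>n. Some (g n)) a n \<longleftrightarrow> g (prod_encode (a, n)) = 0 \<and> (\<forall>m<n. g (prod_encode (a, m)) \<noteq> 0)"
  by (auto simp: mu_root_def not0_implies_Suc)

text \<open>The value is found by a \<open>\<mu>\<close>-search for the code of a pair of a possible value and a witness. This lets
machines be specified by arbitrary enumerable conditions on input and output, without writing programs.\<close>

lemma partial_recursive_if_ce_graph:
  fixes M :: "'a::coded \<rightharpoonup> 'b::decodable"
  assumes "ce (\<lambda>z. M (fst z) = Some (snd z))"
  shows "\<exists>f. partial_recursive f \<and> (\<forall>x. f (enc x) = map_option enc (M x))"
proof -
  obtain R where R0: "computable R" and RS: "\<And>z. M (fst z) = Some (snd z) \<longleftrightarrow> (\<exists>s::nat. R (z, s))"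
    using ceE[OF assms] by blast
  note R = computable_comp[OF R0 computable_Pair]
  let ?S = "\<lambda>x n. R ((x, dec (fst (prod_decode n))), snd (prod_decode n))"
  have "computable (\<lambda>z. if ?S (fst z) (snd z) then 0 else 1 :: nat)"
    by (intro R computable_intros)
  then obtain g where g: "total_recursive g" "\<And>z. g (enc z) = enc (if ?S (fst z) (snd z) then 0 else 1 :: nat)"
    unfolding computable_def by blast
  have g': "g (prod_encode (enc x, n)) = 0 \<longleftrightarrow> ?S x n" for x n
    using g(2)[of "(x, n)"] by (auto simp: enc_prod_def enc_nat_def)
  let ?m = "\<lambda>a. if \<exists>n. mu_root (\<lambda>n. Some (g n)) a n then Some (THE n. mu_root (\<lambda>n. Some (g n)) a n) else None"
  let ?e = "\<lambda>n. enc (dec (fst (prod_decode n)) :: 'b)"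
  have "total_recursive ?e"
    by (rule total_recursive_comp[OF partial_recursive_enc_dec partial_recursive.left])
  from partial_recursive.comp[OF this partial_recursive.mu[OF g(1)]]
  have "partial_recursive (\<lambda>a. Option.bind (?m a) (\<lambda>n. Some (?e n)))" .
  moreover have "Option.bind (?m (enc x)) (\<lambda>n. Some (?e n)) = map_option enc (M x)" for x
  proof (cases "M x")
    case None
    hence "\<not> ?S x n" for n using RS[of "(x, _)"] by auto
    thus ?thesis using None by (simp add: mu_root_total g')
  next
    case (Some y)
    then obtain s where "R ((x, y), s)" using RS[of "(x, y)"] by auto
    hence ex: "\<exists>n. ?S x n" by (metis dec_enc fst_conv snd_conv prod_encode_inverse)
    define n where "n = (LEAST n. ?S x n)"
    have n: "?S x n" "\<And>m. m < n \<Longrightarrow> \<not> ?S x m"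
      unfolding n_def using LeastI_ex[OF ex] not_less_Least by blast+
    have root: "mu_root (\<lambda>n. Some (g n)) (enc x) n" using n by (simp add: mu_root_total g')
    have "(THE n. mu_root (\<lambda>n. Some (g n)) (enc x) n) = n"
      using root n by (intro the_equality) (auto simp: mu_root_total g' dest: linorder_neqE_nat)
    moreover have "dec (fst (prod_decode n)) = y"
      using n(1) RS[of "(x, dec (fst (prod_decode n)))"] Some by auto
    ultimately show ?thesis using root Some by auto
  qed
  ultimately show ?thesis by blast
qed

text \<open>Convergence to a given value is witnessed by the intermediate results of the computation. For
primitive recursion these form a list of unbounded length, which a single existential quantifier supplies.\<close>

lemma ce_graph_if_partial_recursive:
  assumes "partial_recursive f" shows "ce (\<lambda>z. f (fst z) = Some (snd z))"
  using assms
proof (induction rule: partial_recursive.induct)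
  case (pair f g)
  note * = ce_comp[OF pair.IH(1) computable_Pair, simplified] ce_comp[OF pair.IH(2) computable_Pair, simplified]
  have "ce (\<lambda>z. \<exists>a b. f (fst z) = Some a \<and> g (fst z) = Some b \<and> snd z = prod_encode (a, b))"
    by (intro ce_intros * ce_computable computable_intros)
  moreover have "(Option.bind (f n) (\<lambda>a. Option.bind (g n) (\<lambda>b. Some (prod_encode (a, b)))) = Some v) \<longleftrightarrow>
     (\<exists>a b. f n = Some a \<and> g n = Some b \<and> v = prod_encode (a, b))" for n v
    by (auto simp: bind_eq_Some_conv)
  ultimately show ?case by simp
next
  case (comp f g)
  note * = ce_comp[OF comp.IH(1) computable_Pair, simplified] ce_comp[OF comp.IH(2) computable_Pair, simplified]
  have "ce (\<lambda>z. \<exists>a. g (fst z) = Some a \<and> f a = Some (snd z))"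
    by (intro ce_intros * ce_computable computable_intros)
  thus ?case by (simp add: bind_eq_Some_conv)
next
  case (prim_rec f g)
  note * = ce_comp[OF prim_rec.IH(1) computable_Pair, simplified] ce_comp[OF prim_rec.IH(2) computable_Pair, simplified]
  let ?h = "\<lambda>a. rec_nat (f a) (\<lambda>y r. Option.bind r (\<lambda>v. g (prod_encode (a, prod_encode (y, v)))))"
  \<comment> \<open>the list \<open>ws\<close> holds the values of the recursion at \<open>0, \<dots>, m\<close>\<close>
  let ?W = "\<lambda>a m v ws. length ws = Suc m \<and> f a = Some (hd ws) \<and> v = hd (drop m ws) \<and>
      (\<forall>i\<in>set [0..<m]. g (prod_encode (a, prod_encode (i, hd (drop i ws)))) = Some (hd (drop (Suc i) ws)))"
  have "ce (\<lambda>z. \<exists>ws. ?W (fst (prod_decode (fst z))) (snd (prod_decode (fst z))) (snd z) ws)"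
    by (intro ce_intros * ce_computable computable_intros)
  moreover have "?h a m = Some v \<longleftrightarrow> (\<exists>ws. ?W a m v ws)" for a m v
  proof
    show "?h a m = Some v \<Longrightarrow> \<exists>ws. ?W a m v ws"
    proof (induction m arbitrary: v)
      case 0
      then show ?case by (intro exI[of _ "[v]"]) simp
    next
      case (Suc m)
      then obtain u where u: "?h a m = Some u" "g (prod_encode (a, prod_encode (m, u))) = Some v"
        by (auto simp: bind_eq_Some_conv)
      from Suc.IH[OF u(1)] obtain ws where ws: "?W a m u ws" by blast
      have "?W a (Suc m) v (ws @ [v])"
        using ws u(2) by (auto simp: less_Suc_eq nth_append hd_drop_conv_nth)
          (metis hd_append2 length_greater_0_conv zero_less_Suc)
      thus ?case by blast
    qed
  next
    assume "\<exists>ws. ?W a m v ws"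
    then obtain ws where ws: "?W a m v ws" by blast
    have "i \<le> m \<Longrightarrow> ?h a i = Some (hd (drop i ws))" for i
      by (induction i) (use ws in auto)
    from this[of m] show "?h a m = Some v" using ws by simp
  qed
  ultimately show ?case by (simp add: case_prod_beta)
next
  case (mu f)
  note * = ce_comp[OF mu.IH computable_Pair, simplified]
  have "ce (\<lambda>z. f (prod_encode (fst z, snd z)) = Some 0 \<and>
      (\<forall>m\<in>set [0..<snd z]. \<exists>k. f (prod_encode (fst z, m)) = Some (Suc k)))"
    by (intro ce_intros * ce_computable computable_intros)
  moreover have "(if \<exists>n. mu_root f a n then Some (THE n. mu_root f a n) else None) = Some n \<longleftrightarrow> mu_root f a n" for a n
  proof -
    have uniq: "n = n'" if "mu_root f a n" "mu_root f a n'" for n n'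
    proof (rule linorder_cases[of n n'])
      assume "n < n'" thus ?thesis using that unfolding mu_root_def by fastforce
    next
      assume "n' < n" thus ?thesis using that unfolding mu_root_def by fastforce
    qed
    show ?thesis using uniq by (auto intro: theI the_equality)
  qed
  moreover have "(\<forall>m\<in>set [0..<n]. P m) \<longleftrightarrow> (\<forall>m<n. P m)" for n and P :: "nat \<Rightarrow> bool" by auto
  ultimately show ?case by (simp only: mu_root_def)
qed (intro ce_computable computable_intros | simp)+

lemma partial_computable_iff_ce_graph:
  "partial_computable M \<longleftrightarrow> ce (\<lambda>z. M (fst z) = Some (snd z))"
proof
  assume "partial_computable M"
  then obtain f where f: "partial_recursive f" "\<And>\<sigma>. f (enc \<sigma>) = map_option enc (M \<sigma>)"
    unfolding partial_computable_def code_string_eq_enc by (auto simp: code_string_eq_enc[abs_def])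
  note * = ce_comp[OF ce_graph_if_partial_recursive[OF f(1)] computable_Pair, simplified]
  have "ce (\<lambda>z :: bool list \<times> bool list. f (enc (fst z)) = Some (enc (snd z)))"
    by (intro * computable_intros)
  thus "ce (\<lambda>z. M (fst z) = Some (snd z))" by (simp add: f(2))
next
  assume "ce (\<lambda>z. M (fst z) = Some (snd z))"
  from partial_recursive_if_ce_graph[OF this] show "partial_computable M"
    unfolding partial_computable_def code_string_eq_enc[abs_def] .
qed

section \<open>Describing a string by its index in a finite enumerable set\<close>

text \<open>The elements of an enumerable set are numbered in the order of their first appearance, and \<open>F p i x\<close>
says that \<open>x\<close> has number \<open>i\<close> among the elements for the parameter \<open>p\<close>. If the set is finite, then the
numbers stay below its size.\<close>

lemma ce_enumeration:
  fixes B :: "'a::coded \<Rightarrow> 'b::decodable \<Rightarrow> bool"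
  assumes "ce (\<lambda>z. B (fst z) (snd z))"
  obtains F :: "'a \<Rightarrow> nat \<Rightarrow> 'b \<Rightarrow> bool"
  where "ce (\<lambda>z. F (fst z) (fst (snd z)) (snd (snd z)))"
    and "\<And>p i x y. F p i x \<Longrightarrow> F p i y \<Longrightarrow> x = y"
    and "\<And>p x. B p x \<Longrightarrow> finite {y. B p y} \<Longrightarrow> \<exists>i<card {y. B p y}. F p i x"
proof -
  obtain R where R0: "computable R" and R: "\<And>z. B (fst z) (snd z) \<longleftrightarrow> (\<exists>s::nat. R (z, s))"
    using ceE[OF assms] by blast
  note R1 = computable_comp[OF R0 computable_Pair]
  \<comment> \<open>\<open>t\<close> codes a pair of a possible element and a witness; the enumeration runs through all \<open>t\<close>\<close>
  define val :: "nat \<Rightarrow> 'b" where "val t = dec (fst (prod_decode t))" for t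
  define hit where "hit p t \<longleftrightarrow> R ((p, val t), snd (prod_decode t))" for p t
  define fst_hit where "fst_hit p t \<longleftrightarrow> hit p t \<and> (\<forall>s\<in>set [0..<t]. hit p s \<longrightarrow> val s \<noteq> val t)" for p t
  define cnt where "cnt p t = length (filter (\<lambda>s. fst_hit p s) [0..<t])" for p t
  define F where "F p i x \<longleftrightarrow> (\<exists>t. fst_hit p t \<and> cnt p t = i \<and> x = val t)" for p i x
  have cnt: "cnt p t = card {s. s < t \<and> fst_hit p s}" for p t
  proof -
    have "cnt p t = card (set (filter (\<lambda>s. fst_hit p s) [0..<t]))"
      unfolding cnt_def by (subst distinct_card) auto
    also have "set (filter (\<lambda>s. fst_hit p s) [0..<t]) = {s. s < t \<and> fst_hit p s}" by auto
    finally show ?thesis .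
  qed
  have hitB: "hit p t \<Longrightarrow> B p (val t)" for p t
    using R[of "(p, val t)"] by (auto simp: hit_def)
  show thesis
  proof (rule that[of F])
    show "ce (\<lambda>z. F (fst z) (fst (snd z)) (snd (snd z)))"
      unfolding F_def cnt_def fst_hit_def hit_def val_def
      by (intro ce_intros ce_computable computable_intros R1)
  next
    fix p i x y assume "F p i x" "F p i y"
    then obtain s t where st: "fst_hit p s" "fst_hit p t" "cnt p s = cnt p t" "x = val s" "y = val t"
      unfolding F_def by auto
    have "cnt p s < cnt p t" if "s < t" "fst_hit p s" for s t
      unfolding cnt by (rule psubset_card_mono) (use that in auto)
    hence "s = t" using st(1-3) by (metis linorder_neqE_nat less_irrefl)
    thus "x = y" using st by simp
  next
    fix p x assume B: "B p x" and fin: "finite {y. B p y}"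
    \<comment> \<open>\<open>x\<close> gets its number at the least \<open>t\<close> that produces it; the earlier first appearances are other elements\<close>
    obtain s where "R ((p, x), s)" using R[of "(p, x)"] B by auto
    hence ex: "\<exists>t. hit p t \<and> val t = x"
      by (intro exI[of _ "prod_encode (enc x, s)"]) (simp add: hit_def val_def)
    define t where "t = (LEAST t. hit p t \<and> val t = x)"
    have t: "hit p t" "val t = x" and least: "\<And>s. s < t \<Longrightarrow> hit p s \<Longrightarrow> val s \<noteq> x"
      unfolding t_def using LeastI_ex[OF ex] not_less_Least by blast+
    have fh: "fst_hit p t" using t least by (auto simp: fst_hit_def)
    have inj: "inj_on val {s. s < t \<and> fst_hit p s}"
    proof (rule inj_onI)
      fix s s' assume "s \<in> {s. s < t \<and> fst_hit p s}" "s' \<in> {s. s < t \<and> fst_hit p s}" "val s = val s'"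
      thus "s = s'" by (cases s s' rule: linorder_cases) (auto simp: fst_hit_def)
    qed
    have "val ` {s. s < t \<and> fst_hit p s} \<subseteq> {y. B p y} - {x}"
      using hitB least by (auto simp: fst_hit_def)
    hence "val ` {s. s < t \<and> fst_hit p s} \<subset> {y. B p y}" using B by blast
    hence "cnt p t < card {y. B p y}"
      unfolding cnt card_image[OF inj, symmetric] by (rule psubset_card_mono[OF fin])
    thus "\<exists>i<card {y. B p y}. F p i x" using fh t unfolding F_def by blast
  qed
qed

text \<open>A self-delimiting code for numbers. Its length grows like a square root instead of a logarithm, which is
still sublinear, and it is simpler to handle than binary notation.\<close>

definition header :: "nat \<Rightarrow> bool list" where
  "header n = replicate (fst (prod_decode n)) False @ True # replicate (snd (prod_decode n)) False @ [True]"

lemma replicate_False_True_inject: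
  "replicate a False @ True # u = replicate b False @ True # v \<longleftrightarrow> a = b \<and> u = v"
proof (induction a arbitrary: b)
  case 0
  then show ?case by (cases b) auto
next
  case (Suc a)
  then show ?case by (cases b) auto
qed

lemma header_append_inject: "header m @ u = header n @ v \<longleftrightarrow> m = n \<and> u = v"
proof -
  have "prod_decode m = prod_decode n \<longleftrightarrow> m = n" by (metis prod_decode_inverse)
  thus ?thesis
    by (auto simp: header_def replicate_False_True_inject prod_eq_iff)
qed

text \<open>If \<open>n\<close> is the Cantor code of \<open>(a, b)\<close>, then \<open>2 * n\<close> is at least the square of \<open>a + b\<close>.\<close>

lemma length_header: "real (length (header n)) \<le> 2 + sqrt (2 * real n)"
proof -
  obtain a b where ab: "prod_decode n = (a, b)" by fastforce
  hence "n = prod_encode (a, b)" by (metis prod_decode_inverse)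
  hence n: "n = (a + b) * Suc (a + b) div 2 + a" by (simp add: prod_encode_def triangle_def)
  have "even ((a + b) * Suc (a + b))" by simp
  hence "2 * n = (a + b) * Suc (a + b) + 2 * a" unfolding n distrib_left by (subst dvd_mult_div_cancel) auto
  moreover have "(a + b) * (a + b) \<le> (a + b) * Suc (a + b)" by (rule mult_le_mono2) simp
  ultimately have "(a + b) ^ 2 \<le> 2 * n" unfolding power2_eq_square by linarith
  hence "(real (a + b))\<^sup>2 \<le> 2 * real n" by (metis of_nat_le_iff of_nat_mult of_nat_numeral of_nat_power)
  hence "real (a + b) \<le> sqrt (2 * real n)" by (rule real_le_rsqrt)
  thus ?thesis using ab by (simp add: header_def)
qed

text \<open>Every number below the size of the set can be transmitted with \<open>b\<close> bits.\<close>

lemma ex_binary_digits: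
  assumes "i < 2 ^ b" shows "\<exists>v :: bool list. length v = b \<and> horner_sum of_bool 2 v = (i :: nat)"
proof (intro exI conjI)
  show "horner_sum of_bool 2 (map (bit i) [0..<b]) = i"
    unfolding horner_sum_bit_eq_take_bit using assms by (rule take_bit_nat_eq_self)
qed simp

lemma complexity_le: "M \<sigma> = Some \<tau> \<Longrightarrow> complexity M \<tau> \<le> enat (length \<sigma>)"
  unfolding complexity_def by (rule INF_lower) simp

text \<open>The machine reads the parameter \<open>a\<close> and the lengths of the two remaining parts in self-delimiting form,
then \<open>p\<close>, then the number of the wanted element in binary. It is prefix-free because the headers determine
where the input ends.\<close>

theorem complexity_le_log_card:
  fixes B :: "nat \<Rightarrow> bool list \<Rightarrow> bool list \<Rightarrow> bool"
  assumes U: "optimal_prefix_free_machine U"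
    and B: "ce (\<lambda>z. B (fst (fst z)) (snd (fst z)) (snd z))"
  shows "\<exists>c::nat. \<forall>a p b \<tau>. B a p \<tau> \<longrightarrow> finite {\<tau>. B a p \<tau>} \<longrightarrow> card {\<tau>. B a p \<tau>} \<le> 2 ^ b \<longrightarrow>
    complexity U \<tau> \<le> enat (length p + b + length (header a) + length (header (length p)) + length (header b) + c)"
proof -
  obtain F :: "nat \<times> bool list \<Rightarrow> nat \<Rightarrow> bool list \<Rightarrow> bool"
    where F: "ce (\<lambda>z. F (fst z) (fst (snd z)) (snd (snd z)))"
    and F_fun: "\<And>p i x y. F p i x \<Longrightarrow> F p i y \<Longrightarrow> x = y"
    and F_cover: "\<And>p x. B (fst p) (snd p) x \<Longrightarrow> finite {y. B (fst p) (snd p) y} \<Longrightarrow>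
      \<exists>i<card {y. B (fst p) (snd p) y}. F p i x"
    using ce_enumeration[OF B] by blast
  define G where "G \<sigma> \<tau> \<longleftrightarrow> (\<exists>a p v. \<sigma> = header a @ header (length p) @ header (length v) @ p @ v \<and>
    F (a, p) (horner_sum of_bool 2 v) \<tau>)" for \<sigma> \<tau>
  define M where "M \<sigma> = (if \<exists>\<tau>. G \<sigma> \<tau> then Some (THE \<tau>. G \<sigma> \<tau>) else None)" for \<sigma>
  have G_fun: "\<tau> = \<tau>'" if "G \<sigma> \<tau>" "G \<sigma> \<tau>'" for \<sigma> \<tau> \<tau>'
    using that unfolding G_def by (auto simp: header_append_inject) (erule (1) F_fun)
  have M: "M \<sigma> = Some \<tau> \<longleftrightarrow> G \<sigma> \<tau>" for \<sigma> \<tau>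
    unfolding M_def using G_fun by (auto intro: theI the_equality)
  note F' = ce_comp[OF F computable_Pair[OF _ computable_Pair], simplified]
  have "ce (\<lambda>z. G (fst z) (snd z))"
    unfolding G_def header_def
    by (intro ce_intros F' ce_computable computable_intros)
  hence "partial_computable M" unfolding partial_computable_iff_ce_graph M .
  moreover have "\<sigma> = \<sigma>'" if pre: "prefix \<sigma> \<sigma>'" and dom: "\<sigma> \<in> dom M" "\<sigma>' \<in> dom M" for \<sigma> \<sigma>'
  proof -
    obtain \<tau> \<tau>' where "G \<sigma> \<tau>" "G \<sigma>' \<tau>'" using dom by (auto simp: M)
    then obtain a p v a' p' v' zs where
      \<sigma>: "\<sigma> = header a @ header (length p) @ header (length v) @ p @ v"
      and \<sigma>': "\<sigma>' = header a' @ header (length p') @ header (length v') @ p' @ v'"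
      and zs: "\<sigma>' = \<sigma> @ zs"
      using pre unfolding G_def prefix_def by metis
    have "header a' @ header (length p') @ header (length v') @ p' @ v' =
        header a @ header (length p) @ header (length v) @ p @ v @ zs"
      using zs unfolding \<sigma> \<sigma>' by (simp only: append_assoc)
    hence "length p' = length p" "length v' = length v" "p' @ v' = p @ v @ zs"
      unfolding header_append_inject by blast+
    hence "zs = []" using arg_cong[of "p' @ v'" _ length] by force
    thus "\<sigma> = \<sigma>'" using zs by simp
  qed
  ultimately have "prefix_free_machine M" unfolding prefix_free_machine_def by blast
  then obtain c where c: "\<And>\<tau>. complexity U \<tau> \<le> complexity M \<tau> + enat c"
    using U unfolding optimal_prefix_free_machine_def by blast
  show ?thesis
  proof (intro exI[of _ c] allI impI)
    fix a p b \<tau> assume *: "B a p \<tau>" "finite {\<tau>. B a p \<tau>}" "card {\<tau>. B a p \<tau>} \<le> 2 ^ b"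
    obtain i where i: "i < card {\<tau>. B a p \<tau>}" "F (a, p) i \<tau>" using F_cover[of "(a, p)"] * by auto
    then obtain v where v: "length v = b" "horner_sum of_bool 2 v = i"
      using ex_binary_digits[of i b] *(3) by auto
    have "G (header a @ header (length p) @ header b @ p @ v) \<tau>"
      unfolding G_def using i v by blast
    from complexity_le[of M, unfolded M, OF this]
    have "complexity M \<tau> + enat c \<le> enat (length p + b + length (header a) + length (header (length p)) + length (header b) + c)"
      using v by (auto simp: ac_simps dest: add_right_mono[of _ _ "enat c"])
    thus "complexity U \<tau> \<le> enat (length p + b + length (header a) + length (header (length p)) + length (header b) + c)"
      using c[of \<tau>] by (rule order_trans[rotated])
  qed
qed

section \<open>Counting strings\<close>

abbreviation strings :: "nat \<Rightarrow> bool list set" where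
  "strings n \<equiv> {w. length w = n}"

lemma finite_strings: "finite (strings n)" and card_strings: "card (strings n) = 2 ^ n"
  using finite_lists_length_eq[of "UNIV :: bool set" n] card_lists_length_eq[of "UNIV :: bool set" n] by simp_all

lemma set_n_lists_bool: "set (List.n_lists n [False, True]) = strings n"
proof -
  have "set [False, True] = UNIV" by auto
  thus ?thesis by (simp only: set_n_lists) simp
qed

lemma card_extensions:
  assumes "length \<rho> \<le> N" shows "card {z \<in> strings N. prefix \<rho> z} = 2 ^ (N - length \<rho>)"
proof -
  have "{z \<in> strings N. prefix \<rho> z} = (\<lambda>w. \<rho> @ w) ` strings (N - length \<rho>)"
    using assms by (auto simp: prefix_def image_def)
  thus ?thesis by (simp add: card_image card_strings inj_on_def)
qed

text \<open>The sets of extensions to length \<open>N\<close> of the strings in \<open>S\<close> are disjoint.\<close>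

lemma kraft_inequality:
  fixes S :: "bool list set"
  assumes fin: "finite S" and len: "\<And>\<rho>. \<rho> \<in> S \<Longrightarrow> length \<rho> \<le> N"
    and pf: "\<And>\<rho> \<sigma>. \<rho> \<in> S \<Longrightarrow> \<sigma> \<in> S \<Longrightarrow> prefix \<rho> \<sigma> \<Longrightarrow> \<rho> = \<sigma>"
  shows "(\<Sum>\<rho>\<in>S. 2 ^ (N - length \<rho>)) \<le> (2::nat) ^ N"
proof -
  have "(\<Sum>\<rho>\<in>S. 2 ^ (N - length \<rho>)) = (\<Sum>\<rho>\<in>S. card {z \<in> strings N. prefix \<rho> z})"
    using len by (intro sum.cong) (simp_all add: card_extensions[unfolded mem_Collect_eq])
  also have "\<dots> = card (\<Union>\<rho>\<in>S. {z \<in> strings N. prefix \<rho> z})"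
  proof (rule card_UN_disjoint[symmetric, OF fin])
    show "\<forall>i\<in>S. finite {z \<in> strings N. prefix i z}" using finite_strings by simp
    show "\<forall>i\<in>S. \<forall>j\<in>S. i \<noteq> j \<longrightarrow> {z \<in> strings N. prefix i z} \<inter> {z \<in> strings N. prefix j z} = {}"
      using pf prefix_same_cases by blast
  qed
  also have "\<dots> \<le> card (strings N)" by (rule card_mono) (auto simp: finite_strings)
  finally show ?thesis by (simp add: card_strings)
qed

subsection \<open>Compressible strings\<close>

definition compressible :: "(bool list \<rightharpoonup> bool list) \<Rightarrow> bool list \<Rightarrow> bool" where
  "compressible U z \<longleftrightarrow> (\<exists>\<rho> \<tau>. U \<rho> = Some \<tau> \<and> length \<rho> < length \<tau> \<and> prefix \<tau> z)"

lemma compressible_append: "compressible U z \<Longrightarrow> compressible U (z @ w)"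
  unfolding compressible_def by (meson prefix_order.trans prefixI)

lemma complexity_ge_if_not_compressible:
  assumes "\<not> compressible U z" "prefix \<tau> z" shows "enat (length \<tau>) \<le> complexity U \<tau>"
  unfolding complexity_def by (rule INF_greatest) (use assms in \<open>auto simp: compressible_def not_less\<close>)

text \<open>Each compressible string extends the output of a program that is at least one bit shorter than the
output, so the measure of these strings is at most half of the sum in Kraft's inequality.\<close>

lemma card_compressible:
  assumes "prefix_free_machine U"
  shows "2 * card {z \<in> strings N. compressible U z} \<le> 2 ^ N"
proof -
  define S where "S = {\<rho>. \<exists>\<tau>. U \<rho> = Some \<tau> \<and> length \<rho> < length \<tau> \<and> length \<tau> \<le> N}"
  have "S \<subseteq> (\<Union>n\<in>{..N}. strings n)" by (auto simp: S_def)
  hence fin: "finite S" by (rule finite_subset) (simp add: finite_strings)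
  have "{z \<in> strings N. compressible U z} \<subseteq> (\<Union>\<rho>\<in>S. {z \<in> strings N. prefix (the (U \<rho>)) z})"
  proof
    fix z assume "z \<in> {z \<in> strings N. compressible U z}"
    then obtain \<rho> \<tau> where *: "length z = N" "U \<rho> = Some \<tau>" "length \<rho> < length \<tau>" "prefix \<tau> z"
      by (auto simp: compressible_def)
    hence "\<rho> \<in> S" using prefix_length_le[of \<tau> z] by (auto simp: S_def)
    thus "z \<in> (\<Union>\<rho>\<in>S. {z \<in> strings N. prefix (the (U \<rho>)) z})" using * by force
  qed
  hence "card {z \<in> strings N. compressible U z} \<le> card (\<Union>\<rho>\<in>S. {z \<in> strings N. prefix (the (U \<rho>)) z})"
    by (rule card_mono[rotated]) (use fin finite_strings in simp)
  also have "\<dots> \<le> (\<Sum>\<rho>\<in>S. card {z \<in> strings N. prefix (the (U \<rho>)) z})" by (rule card_UN_le[OF fin])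
  finally have "2 * card {z \<in> strings N. compressible U z} \<le> (\<Sum>\<rho>\<in>S. 2 * card {z \<in> strings N. prefix (the (U \<rho>)) z})"
    by (simp add: sum_distrib_left[symmetric])
  also have "\<dots> \<le> (\<Sum>\<rho>\<in>S. 2 ^ (N - length \<rho>))"
  proof (rule sum_mono)
    fix \<rho> assume "\<rho> \<in> S"
    then obtain \<tau> where \<tau>: "U \<rho> = Some \<tau>" "length \<rho> < length \<tau>" "length \<tau> \<le> N" by (auto simp: S_def)
    have "2 * card {z \<in> strings N. prefix (the (U \<rho>)) z} = 2 ^ Suc (N - length \<tau>)"
      using \<tau> by (simp add: card_extensions[unfolded mem_Collect_eq])
    also have "\<dots> \<le> 2 ^ (N - length \<rho>)" using \<tau> by (intro power_increasing) auto
    finally show "2 * card {z \<in> strings N. prefix (the (U \<rho>)) z} \<le> 2 ^ (N - length \<rho>)" .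
  qed
  also have "\<dots> \<le> 2 ^ N"
  proof (rule kraft_inequality[OF fin])
    show "length \<rho> \<le> N" if "\<rho> \<in> S" for \<rho> using that by (auto simp: S_def)
    show "\<rho> = \<sigma>" if "\<rho> \<in> S" "\<sigma> \<in> S" "prefix \<rho> \<sigma>" for \<rho> \<sigma>
      using that assms unfolding prefix_free_machine_def S_def by blast
  qed
  finally show ?thesis .
qed

subsection \<open>Strings with many incompressible extensions\<close>

definition incompressible_exts :: "(bool list \<rightharpoonup> bool list) \<Rightarrow> bool list \<Rightarrow> nat \<Rightarrow> bool list set" where
  "incompressible_exts U y N = {w \<in> strings N. \<not> compressible U (y @ w)}"

text \<open>The fraction of incompressible strings among the extensions of \<open>y\<close> by \<open>N\<close> bits decreases with \<open>N\<close> to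
the conditional measure, in the cylinder of \<open>y\<close>, of the class of sequences without compressible prefix. So
\<open>good U q y\<close> says that this conditional measure is at least \<open>2\<^sup>-\<^sup>q\<close>.\<close>

definition good :: "(bool list \<rightharpoonup> bool list) \<Rightarrow> nat \<Rightarrow> bool list \<Rightarrow> bool" where
  "good U q y \<longleftrightarrow> (\<forall>N. 2 ^ N \<le> card (incompressible_exts U y N) * 2 ^ q)"

lemma finite_incompressible_exts: "finite (incompressible_exts U y N)"
  by (simp add: incompressible_exts_def finite_strings)

lemma good_Nil:
  assumes "prefix_free_machine U" shows "good U 1 []"
  unfolding good_def
proof
  fix N
  have "incompressible_exts U [] N = strings N - {z \<in> strings N. compressible U z}"
    by (auto simp: incompressible_exts_def)
  moreover have "card (strings N - {z \<in> strings N. compressible U z})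
      = card (strings N) - card {z \<in> strings N. compressible U z}"
    by (rule card_Diff_subset) (auto simp: finite_strings)
  ultimately show "2 ^ N \<le> card (incompressible_exts U [] N) * 2 ^ 1"
    using card_compressible[OF assms, of N] by (simp add: card_strings)
qed

text \<open>At level \<open>0\<close> the only extension is \<open>y\<close> itself.\<close>

lemma good_imp_not_compressible: "good U q y \<Longrightarrow> \<not> compressible U y"
proof
  assume "good U q y" "compressible U y"
  hence "incompressible_exts U y 0 = {}" by (simp add: incompressible_exts_def)
  with \<open>good U q y\<close>[unfolded good_def, rule_format, of 0] show False by simp
qed

text \<open>The fraction of incompressible extensions does not increase with the level.\<close>

lemma card_incompressible_exts_add:
  "card (incompressible_exts U y (N + M)) \<le> card (incompressible_exts U y N) * 2 ^ M"
proof -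
  have "incompressible_exts U y (N + M) \<subseteq> (\<lambda>(u, v). u @ v) ` (incompressible_exts U y N \<times> strings M)"
  proof
    fix w assume w: "w \<in> incompressible_exts U y (N + M)"
    hence "take N w \<in> incompressible_exts U y N" "drop N w \<in> strings M"
      using compressible_append[of U "y @ take N w" "drop N w"] by (auto simp: incompressible_exts_def)
    thus "w \<in> (\<lambda>(u, v). u @ v) ` (incompressible_exts U y N \<times> strings M)"
      by (intro image_eqI[of _ _ "(take N w, drop N w)"]) auto
  qed
  hence "card (incompressible_exts U y (N + M)) \<le> card ((\<lambda>(u, v). u @ v) ` (incompressible_exts U y N \<times> strings M))"
    by (rule card_mono[rotated]) (simp add: finite_strings finite_incompressible_exts)
  also have "\<dots> \<le> card (incompressible_exts U y N \<times> strings M)"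
    by (rule card_image_le) (simp add: finite_strings finite_incompressible_exts)
  finally show ?thesis by (simp add: card_cartesian_product card_strings)
qed

lemma card_incompressible_exts_split:
  "card (incompressible_exts U y (l + N)) \<le> (\<Sum>z\<in>strings l. card (incompressible_exts U (y @ z) N))"
proof -
  have "incompressible_exts U y (l + N) \<subseteq> (\<Union>z\<in>strings l. (\<lambda>w. z @ w) ` incompressible_exts U (y @ z) N)"
  proof
    fix w assume "w \<in> incompressible_exts U y (l + N)"
    thus "w \<in> (\<Union>z\<in>strings l. (\<lambda>w. z @ w) ` incompressible_exts U (y @ z) N)"
      by (intro UN_I[of "take l w"] image_eqI[of _ _ "drop l w"]) (auto simp: incompressible_exts_def)
  qed
  hence "card (incompressible_exts U y (l + N)) \<le> card (\<Union>z\<in>strings l. (\<lambda>w. z @ w) ` incompressible_exts U (y @ z) N)"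
    by (rule card_mono[rotated]) (simp add: finite_strings finite_incompressible_exts)
  also have "\<dots> \<le> (\<Sum>z\<in>strings l. card ((\<lambda>w. z @ w) ` incompressible_exts U (y @ z) N))"
    by (rule card_UN_le) (rule finite_strings)
  also have "\<dots> \<le> (\<Sum>z\<in>strings l. card (incompressible_exts U (y @ z) N))"
    by (intro sum_mono card_image_le finite_incompressible_exts)
  finally show ?thesis .
qed

text \<open>If the conditional measure in the cylinder of \<open>y\<close> is at least \<open>2\<^sup>-\<^sup>q\<close>, then the extensions whose
conditional measure is below half of that contribute less than \<open>2\<^sup>-\<^sup>q\<^sup>-\<^sup>1\<close>, so the others must make up at
least the fraction \<open>2\<^sup>-\<^sup>q\<^sup>-\<^sup>1\<close> of all extensions.\<close>

lemma good_extensions: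
  assumes "good U q y"
  shows "2 ^ l \<le> card {z \<in> strings l. good U (Suc q) (y @ z)} * 2 ^ Suc q"
proof -
  define A where "A = {z \<in> strings l. good U (Suc q) (y @ z)}"
  have finA: "finite A" "A \<subseteq> strings l" by (auto simp: A_def finite_strings)
  \<comment> \<open>\<open>n z\<close> is a level at which it shows that \<open>z\<close> is not in \<open>A\<close>; at \<open>N\<close> it shows for all these \<open>z\<close> at once\<close>
  define n where "n z = (SOME N. card (incompressible_exts U (y @ z) N) * 2 ^ Suc q < 2 ^ N)" for z
  have n: "card (incompressible_exts U (y @ z) (n z)) * 2 ^ Suc q < 2 ^ n z" if "z \<in> strings l - A" for z
  proof -
    have "\<exists>N. card (incompressible_exts U (y @ z) N) * 2 ^ Suc q < 2 ^ N"
      using that by (auto simp: A_def good_def not_le)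
    from someI_ex[OF this] show ?thesis unfolding n_def .
  qed
  define N where "N = (\<Sum>z\<in>strings l. n z)"
  have bad: "card (incompressible_exts U (y @ z) N) * 2 ^ Suc q \<le> 2 ^ N" if z: "z \<in> strings l - A" for z
  proof -
    have "n z \<le> N" unfolding N_def using z by (intro member_le_sum) (auto simp: finite_strings)
    then obtain M where M: "N = n z + M" using le_Suc_ex by blast
    have "card (incompressible_exts U (y @ z) N) * 2 ^ Suc q \<le>
        card (incompressible_exts U (y @ z) (n z)) * 2 ^ M * 2 ^ Suc q"
      unfolding M by (intro mult_right_mono card_incompressible_exts_add) simp
    also have "\<dots> = card (incompressible_exts U (y @ z) (n z)) * 2 ^ Suc q * 2 ^ M" by simp
    also have "\<dots> \<le> 2 ^ n z * 2 ^ M" using n[OF z] by (intro mult_right_mono) auto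
    finally show ?thesis by (simp add: M power_add)
  qed
  have all: "card (incompressible_exts U (y @ z) N) \<le> 2 ^ N" for z
    using card_mono[OF finite_strings, of "incompressible_exts U (y @ z) N" N]
    by (auto simp: incompressible_exts_def card_strings)
  have "2 ^ (l + N) * 2 \<le> card (incompressible_exts U y (l + N)) * 2 ^ q * 2"
    using assms unfolding good_def by (intro mult_right_mono) auto
  also have "\<dots> \<le> (\<Sum>z\<in>strings l. card (incompressible_exts U (y @ z) N)) * 2 ^ Suc q"
    using card_incompressible_exts_split[of U y l N] by simp
  also have "\<dots> = (\<Sum>z\<in>strings l. card (incompressible_exts U (y @ z) N) * 2 ^ Suc q)"
    by (rule sum_distrib_right)
  also have "\<dots> \<le> (\<Sum>z\<in>strings l. 2 ^ N + (if z \<in> A then 2 ^ N * 2 ^ Suc q else 0))"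
  proof (rule sum_mono)
    fix z assume "z \<in> strings l"
    thus "card (incompressible_exts U (y @ z) N) * 2 ^ Suc q \<le> 2 ^ N + (if z \<in> A then 2 ^ N * 2 ^ Suc q else 0)"
      using bad[of z] trans_le_add2[OF mult_le_mono1[OF all[of z], of "2 ^ Suc q"]] by (cases "z \<in> A") simp_all
  qed
  also have "\<dots> = 2 ^ l * 2 ^ N + card A * (2 ^ N * 2 ^ Suc q)"
    using finA by (simp add: sum.distrib card_strings finite_strings sum.If_cases Int_absorb1)
  finally have "2 ^ N * 2 ^ l \<le> 2 ^ N * (card A * 2 ^ Suc q)" by (simp add: power_add algebra_simps)
  thus ?thesis unfolding A_def by (simp only: mult_le_cancel1) simp
qed

section \<open>Hamming distance and concentration of measure\<close>

text \<open>The Hamming distance of strings of equal length, written with list functions so that it is visibly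
computable.\<close>

definition mism :: "bool list \<Rightarrow> bool list \<Rightarrow> nat" where
  "mism x y = length (filter (\<lambda>p. fst p \<noteq> snd p) (zip x y))"

lemma mism_simps [simp]: "mism [] y = 0" "mism x [] = 0"
  "mism (a # x) (b # y) = of_bool (a \<noteq> b) + mism x y"
  by (simp_all add: mism_def)

lemma mism_append: "length x = length y \<Longrightarrow> mism (x @ u) (y @ v) = mism x y + mism u v"
  by (simp add: mism_def)

lemma mism_le: "mism x y \<le> length y"
  unfolding mism_def by (rule order_trans[OF length_filter_le]) simp

lemma hamming_dist_eq_mism:
  assumes "length x = length y" shows "hamming_dist x y = real (mism x y) / real (length x)"
proof -
  have "mism x y = card {k. k < length x \<and> x ! k \<noteq> y ! k}"
    unfolding mism_def length_filter_conv_card using assms by (intro arg_cong[of _ _ card]) auto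
  thus ?thesis by (simp add: hamming_dist_def)
qed

lemma strings_Suc: "strings (Suc l) = (#) True ` strings l \<union> (#) False ` strings l"
proof (intro set_eqI)
  fix w show "w \<in> strings (Suc l) \<longleftrightarrow> w \<in> (#) True ` strings l \<union> (#) False ` strings l"
    by (cases w) (auto simp: image_iff)
qed

lemma sum_strings_Suc:
  "(\<Sum>w\<in>strings (Suc l). f w) = (\<Sum>w\<in>strings l. f (True # w)) + (\<Sum>w\<in>strings l. f (False # w))"
  unfolding strings_Suc
  by (subst sum.union_disjoint) (auto simp: finite_strings sum.reindex)

text \<open>The induction step of the concentration inequality: \<open>a0\<close> and \<open>a1\<close> are the sizes of the two halves of the set,
\<open>s0\<close> and \<open>s1\<close> the total weights of the two halves of the cube, and crossing from one half to the other
costs a factor \<open>T\<close>. The worst case is a ratio \<open>T\<close> between the sizes.\<close>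

lemma two_point_concentration:
  fixes a0 a1 s0 s1 c T :: real
  assumes "a0 \<ge> 0" "a1 \<ge> 0" "c \<ge> 0" "T \<ge> 1"
    and "s0 * a0 \<le> c" "s1 * a1 \<le> c" "s0 * a1 \<le> c * T" "s1 * a0 \<le> c * T"
  shows "(s0 + s1) * (a0 + a1) \<le> c * (2 + T + 1 / T)"
proof -
  have main: "s0 * a1 + s1 * a0 \<le> c * (T + 1 / T)"
    if le: "a1 \<le> a0" and a: "a1 \<ge> 0" and s: "s0 * a0 \<le> c" "s1 * a1 \<le> c" "s1 * a0 \<le> c * T" for a0 a1 s0 s1 :: real
  proof (cases "a0 = 0")
    case True
    then show ?thesis using le a assms(3,4) by simp
  next
    case False
    hence a0: "a0 > 0" using le a by simp
    have s0: "s0 * a1 \<le> c * (a1 / a0)"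
    proof -
      have "s0 * a1 = (s0 * a0) * (a1 / a0)" using a0 by simp
      also have "\<dots> \<le> c * (a1 / a0)" using s(1) a a0 by (intro mult_right_mono) auto
      finally show ?thesis .
    qed
    show ?thesis
    proof (cases "a0 \<le> T * a1")
      case True
      hence a1: "a1 > 0" using a0 a assms(4) by (metis less_eq_real_def mult_zero_right not_less)
      have "s1 * a0 = (s1 * a1) * (a0 / a1)" using a1 by simp
      also have "\<dots> \<le> c * (a0 / a1)" using s(2) a0 a1 by (intro mult_right_mono) auto
      finally have s1: "s1 * a0 \<le> c * (a0 / a1)" .
      define r where "r = a0 / a1"
      have r: "1 \<le> r" "r \<le> T" using le True a1 by (auto simp: r_def field_simps)
      have "0 \<le> (T - r) * (T * r - 1)" using r assms(4) mult_mono[of 1 T 1 r] by (intro mult_nonneg_nonneg) auto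
      hence "r + 1 / r \<le> T + 1 / T" using r assms(4) by (simp add: field_simps)
      hence "c * (a0 / a1 + a1 / a0) \<le> c * (T + 1 / T)"
        using assms(3) a0 a1 by (intro mult_left_mono) (auto simp: r_def)
      thus ?thesis using s0 s1 by (simp add: distrib_left)
    next
      case False
      hence "a1 / a0 \<le> 1 / T" using a0 assms(4) by (simp add: field_simps)
      hence "c * (a1 / a0) \<le> c * (1 / T)" using assms(3) by (intro mult_left_mono) auto
      thus ?thesis using s0 s(3) by (simp add: distrib_left)
    qed
  qed
  have "s0 * a1 + s1 * a0 \<le> c * (T + 1 / T)"
  proof (cases "a1 \<le> a0")
    case True
    then show ?thesis using main assms by blast
  next
    case False
    then show ?thesis using main[of a0 a1 s1 s0] assms by simp
  qed
  thus ?thesis using assms(5,6) by (simp add: algebra_simps)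
qed

text \<open>The exponential moment of the distance to \<open>A\<close>: the largest function \<open>g\<close> that satisfies the hypothesis is
\<open>T\<close> to the power of that distance. Working with an arbitrary \<open>g\<close> below it makes the induction on the dimension
uniform, without a special treatment of empty sections of \<open>A\<close>.\<close>

lemma concentration:
  fixes g :: "bool list \<Rightarrow> real"
  assumes T: "T \<ge> 1" and "A \<subseteq> strings l" and "\<And>x a. x \<in> strings l \<Longrightarrow> a \<in> A \<Longrightarrow> g x \<le> T ^ mism x a"
  shows "(\<Sum>x\<in>strings l. g x) * real (card A) \<le> (2 + T + 1 / T) ^ l"
  using assms(2,3)
proof (induction l arbitrary: g A)
  case 0
  hence "A = {} \<or> A = {[]}" by auto
  thus ?case using 0(2)[of "[]" "[]"] by auto
next
  case (Suc l)
  define Ab where "Ab b = {w. b # w \<in> A}" for b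
  define s where "s b = (\<Sum>w\<in>strings l. g (b # w))" for b
  define c where "c = (2 + T + 1 / T) ^ l"
  have c: "c \<ge> 0" using T by (simp add: c_def)
  have Ab: "Ab b \<subseteq> strings l" for b using Suc.prems(1) by (auto simp: Ab_def)
  hence fin: "finite (Ab b)" for b using finite_strings finite_subset by metis
  have "A = (#) True ` Ab True \<union> (#) False ` Ab False"
  proof (intro set_eqI)
    fix w show "w \<in> A \<longleftrightarrow> w \<in> (#) True ` Ab True \<union> (#) False ` Ab False"
      using Suc.prems(1) by (cases w; cases "hd w") (auto simp: Ab_def image_iff)
  qed
  hence "card A = card ((#) True ` Ab True \<union> (#) False ` Ab False)" by simp
  also have "\<dots> = card (Ab True) + card (Ab False)"
    by (subst card_Un_disjoint) (auto simp: fin card_image)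
  finally have card: "card A = card (Ab True) + card (Ab False)" .
  have same: "s b * real (card (Ab b)) \<le> c" for b
    unfolding s_def c_def
  proof (rule Suc.IH[OF Ab])
    fix x a assume "x \<in> strings l" "a \<in> Ab b"
    thus "g (b # x) \<le> T ^ mism x a" using Suc.prems(2)[of "b # x" "b # a"] by (simp add: Ab_def)
  qed
  \<comment> \<open>comparing one half of the cube with the part of \<open>A\<close> in the other half adds \<open>1\<close> to each distance\<close>
  have diff: "s b * real (card (Ab (\<not> b))) \<le> c * T" for b
  proof -
    have "(\<Sum>x\<in>strings l. g (b # x) / T) * real (card (Ab (\<not> b))) \<le> c"
      unfolding c_def
    proof (rule Suc.IH[OF Ab])
      fix x a assume "x \<in> strings l" "a \<in> Ab (\<not> b)"
      thus "g (b # x) / T \<le> T ^ mism x a"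
        using T Suc.prems(2)[of "b # x" "(\<not> b) # a"] by (simp add: Ab_def field_simps)
    qed
    thus ?thesis using T by (simp add: s_def sum_divide_distrib[symmetric] field_simps)
  qed
  have "(s True + s False) * (real (card (Ab True)) + real (card (Ab False))) \<le> c * (2 + T + 1 / T)"
    using same[of True] same[of False] diff[of True] diff[of False] T c
    by (intro two_point_concentration) auto
  thus ?case unfolding sum_strings_Suc by (simp add: s_def card c_def mult.commute)
qed

lemma exp_le_powr: "x \<ge> 0 \<Longrightarrow> exp x \<le> 2 powr (2 * x :: real)"
proof -
  assume x: "x \<ge> 0"
  have "exp (1/2 :: real) ^ 2 = exp 1" by (simp flip: exp_of_nat_mult)
  also have "\<dots> \<le> 2 ^ 2" using exp_le by simp
  finally have "exp (1/2 :: real) \<le> 2" by (rule power2_le_imp_le) simp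
  hence "1/2 \<le> ln (2::real)" by (subst ln_ge_iff) auto
  hence "x \<le> 2 * x * ln 2" using x mult_left_mono[of "1/2" "ln 2" "2 * x"] by simp
  thus ?thesis by (simp add: powr_def)
qed

lemma exp_minus_le_powr: "x \<ge> 0 \<Longrightarrow> exp (- x) \<le> 2 powr (- x :: real)"
proof -
  assume x: "x \<ge> 0"
  have "ln (2::real) \<le> 1" using ln_le_minus_one[of "2::real"] by simp
  hence "x * ln 2 \<le> x" using x mult_left_mono[of "ln 2" 1 x] by simp
  thus ?thesis by (simp add: powr_def)
qed

text \<open>Markov's inequality for the exponential moment with \<open>T = 1 + 1/k\<close>. For this \<open>T\<close> the moment grows by a
factor \<open>1 + h/4\<close> per bit, where \<open>h = 1/(k(k+1))\<close>, whereas distance more than \<open>l/k\<close> makes the weight at least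
\<open>T\<close> to the power \<open>l/k\<close>, that is, at least \<open>exp h\<close> per bit.\<close>

lemma card_far_from_large_set:
  assumes A: "A \<subseteq> strings l" and large: "2 ^ l \<le> card A * 2 ^ q" and k: "k \<ge> 1"
  shows "real (card {x \<in> strings l. \<forall>a\<in>A. l < k * mism x a})
    \<le> 2 powr (real q + real l - real l / (2 * real k * (real k + 1)))"
proof -
  define F where "F = {x \<in> strings l. \<forall>a\<in>A. l < k * mism x a}"
  define T :: real where "T = 1 + 1 / real k"
  define h :: real where "h = 1 / (real k * (real k + 1))"
  define E where "E = exp (real l * h)"
  have kpos: "real k > 0" using k by simp
  have h: "h > 0" using kpos by (simp add: h_def)
  have T: "T \<ge> 1" using kpos by (simp add: T_def)
  have "ln (1 / T) \<le> 1 / T - 1" using T by (intro ln_le_minus_one) auto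
  hence "1 - 1 / T \<le> ln T" using T by (simp add: ln_div)
  moreover have "1 - 1 / T = real k * h" proof -
    have "1 - 1 / T = 1 / (real k + 1)" using kpos by (simp add: T_def field_simps)
    thus ?thesis using kpos by (simp add: h_def)
  qed
  ultimately have lnT: "real k * h \<le> ln T" by simp
  have E_le: "E \<le> T ^ n" if "l < k * n" for n
  proof -
    have "real l * h \<le> real (k * n) * h" using that h by (intro mult_right_mono of_nat_mono) auto
    also have "\<dots> = real n * (real k * h)" by simp
    also have "\<dots> \<le> real n * ln T" using lnT by (intro mult_left_mono) auto
    finally have "E \<le> exp (real n * ln T)" by (simp add: E_def)
    also have "\<dots> = T ^ n" using T by (simp add: exp_of_nat_mult)
    finally show ?thesis .
  qed
  have finF: "finite F" "F \<subseteq> strings l" unfolding F_def by (auto simp: finite_strings)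
  have "(\<Sum>x\<in>strings l. if x \<in> F then E else 0) * real (card A) \<le> (2 + T + 1 / T) ^ l"
  proof (rule concentration[OF T A])
    fix x a assume "x \<in> strings l" "a \<in> A"
    thus "(if x \<in> F then E else 0) \<le> T ^ mism x a" using E_le T by (auto simp: F_def)
  qed
  hence 1: "real (card F) * E * real (card A) \<le> (2 + T + 1 / T) ^ l"
    using finF by (simp add: sum.If_cases finite_strings Int_absorb1)
  have "2 + (r + 1) / r + r / (r + 1) = 4 * (1 + 1 / (r * (r + 1)) / 4)" if "r > 0" for r :: real
  proof -
    have "r + 1 \<noteq> 0" "r \<noteq> 0" using that by auto
    thus ?thesis by (simp add: divide_simps) (simp add: algebra_simps)
  qed
  moreover have "T = (real k + 1) / real k" using kpos by (simp add: T_def field_simps)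
  ultimately have "2 + T + 1 / T = 4 * (1 + h / 4)" using kpos by (simp add: h_def)
  also have "\<dots> \<le> 4 * exp (h / 4)" by (intro mult_left_mono exp_ge_add_one_self) simp
  finally have "(2 + T + 1 / T) ^ l \<le> (4 * exp (h / 4)) ^ l" using T by (intro power_mono) auto
  also have "\<dots> = 2 ^ l * 2 ^ l * exp (real l * h / 4)"
  proof -
    have "(4::real) ^ l = 2 ^ l * 2 ^ l" by (simp flip: power_mult_distrib)
    moreover have "exp (h / 4) ^ l = exp (real l * h / 4)" by (simp flip: exp_of_nat_mult)
    ultimately show ?thesis by (simp add: power_mult_distrib)
  qed
  finally have 2: "(2 + T + 1 / T) ^ l \<le> 2 ^ l * 2 ^ l * exp (real l * h / 4)" .
  have "real (2 ^ l) \<le> real (card A * 2 ^ q)" using large by (rule of_nat_mono)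
  hence "real (card F) * E * 2 ^ l \<le> real (card F) * E * (real (card A) * 2 ^ q)"
    by (intro mult_left_mono) (auto simp: E_def)
  also have "\<dots> = (real (card F) * E * real (card A)) * 2 ^ q" by simp
  also have "\<dots> \<le> (2 ^ l * 2 ^ l * exp (real l * h / 4)) * 2 ^ q"
    using 1 2 by (intro mult_right_mono) auto
  also have "\<dots> = (2 ^ l * exp (real l * h / 4) * 2 ^ q) * 2 ^ l" by (simp only: mult_ac)
  finally have "real (card F) * E \<le> 2 ^ l * exp (real l * h / 4) * 2 ^ q"
    by (rule mult_right_le_imp_le) simp
  hence "real (card F) \<le> 2 ^ l * 2 ^ q * (exp (real l * h / 4) / E)"
    by (simp add: E_def field_simps)
  also have "exp (real l * h / 4) / E = exp (- (3 / 4 * (real l * h)))"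
    by (simp add: E_def flip: exp_diff)
  also have "\<dots> \<le> exp (- (1 / 2 * (real l * h)))" using h by simp
  also have "\<dots> \<le> 2 powr (- (1 / 2 * (real l * h)))" using h by (intro exp_minus_le_powr) simp
  finally have "real (card F) \<le> 2 ^ l * 2 ^ q * 2 powr (- (1 / 2 * (real l * h)))"
    by (simp add: mult_left_mono)
  also have "\<dots> = 2 powr (real q + real l - 1 / 2 * (real l * h))"
  proof -
    have "2 ^ l * 2 ^ q * 2 powr x = 2 powr (real l + real q + x)" for x :: real
      by (simp add: powr_add powr_realpow)
    thus ?thesis by (simp add: algebra_simps)
  qed
  also have "1 / 2 * (real l * h) = real l / (2 * real k * (real k + 1))" by (simp add: h_def)
  finally show ?thesis unfolding F_def .
qed

lemma sum_power_mism: "(\<Sum>\<tau>\<in>strings (length x). t ^ mism x \<tau>) = (1 + t :: real) ^ length x"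
proof (induction x)
  case Nil
  have "strings 0 = {[]}" by auto
  then show ?case by simp
next
  case (Cons a x)
  then show ?case unfolding list.size(4) add_Suc_right add_0_right sum_strings_Suc
    by (cases a) (simp_all add: sum_distrib_left[symmetric] algebra_simps)
qed

text \<open>Give each string the weight \<open>t\<close> to the power of its distance from \<open>x\<close>, where \<open>t = 1/s\<close>. The total weight is at most
\<open>exp (n/s)\<close>, and in a ball of radius \<open>n/s\<^sup>2\<close> each weight is at least \<open>exp (-n/s)\<close>.\<close>

lemma card_hamming_ball:
  assumes s: "s \<ge> 1"
  shows "real (card {\<tau>. length \<tau> = length x \<and> s * s * mism x \<tau> \<le> length x}) \<le> 2 powr (4 * real (length x) / real s)"
proof -
  define n where "n = length x"
  define F where "F = {\<tau>. length \<tau> = n \<and> s * s * mism x \<tau> \<le> n}"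
  define t where "t = 1 / real s"
  have t: "0 < t" "t \<le> 1" using s by (auto simp: t_def)
  have fin: "finite F" "F \<subseteq> strings n" by (auto simp: F_def intro: finite_subset[OF _ finite_strings])
  have lns: "ln (real s) \<le> real s" using s ln_le_minus_one[of "real s"] by simp
  have ge: "exp (- (real n / real s)) \<le> t ^ mism x \<tau>" if "\<tau> \<in> F" for \<tau>
  proof -
    have "real (s * s * mism x \<tau>) \<le> real n" using that by (simp only: F_def mem_Collect_eq of_nat_le_iff)
    hence "real s * (real s * real (mism x \<tau>)) \<le> real n" by simp
    hence "real (mism x \<tau>) * real s \<le> real n / real s" using s by (simp add: field_simps)
    moreover have "real (mism x \<tau>) * ln (real s) \<le> real (mism x \<tau>) * real s"
      using lns by (intro mult_left_mono) auto
    ultimately have "exp (- (real n / real s)) \<le> exp (- (real (mism x \<tau>) * ln (real s)))" by simp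
    also have "\<dots> = t ^ mism x \<tau>"
      using s by (simp add: exp_minus exp_of_nat_mult t_def power_one_over inverse_eq_divide)
    finally show ?thesis .
  qed
  have "real (card F) * exp (- (real n / real s)) = (\<Sum>\<tau>\<in>F. exp (- (real n / real s)))" by simp
  also have "\<dots> \<le> (\<Sum>\<tau>\<in>F. t ^ mism x \<tau>)" by (rule sum_mono) (rule ge)
  also have "\<dots> \<le> (\<Sum>\<tau>\<in>strings n. t ^ mism x \<tau>)"
    using fin t by (intro sum_mono2) (auto simp: finite_strings)
  also have "\<dots> = (1 + t) ^ n" unfolding n_def by (rule sum_power_mism)
  also have "\<dots> \<le> exp t ^ n" using t by (intro power_mono) auto
  also have "\<dots> = exp (real n / real s)" by (simp add: t_def flip: exp_of_nat_mult)
  finally have "real (card F) \<le> exp (real n / real s) * exp (real n / real s)"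
    by (simp add: exp_minus field_simps)
  also have "\<dots> = exp (2 * (real n / real s))" by (simp flip: exp_add)
  also have "\<dots> \<le> 2 powr (2 * (2 * (real n / real s)))" by (rule exp_le_powr) simp
  finally show ?thesis by (simp add: F_def n_def)
qed

section \<open>Complexity up to sublinear terms\<close>

lemma computable_zip:
  assumes "computable f" "computable g" shows "computable (\<lambda>x. zip (f x) (g x))"
proof -
  have "computable (\<lambda>x. map (\<lambda>i. (hd (drop i (f x)), hd (drop i (g x))))
      [0..<if length (f x) \<le> length (g x) then length (f x) else length (g x)])"
    by (intro computable_intros assms computable_comp[OF assms(1)] computable_comp[OF assms(2)])
  moreover have "map (\<lambda>i. (hd (drop i u), hd (drop i v)))
      [0..<if length u \<le> length v then length u else length v] = zip u v" for u :: "'b list" and v :: "'c list"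
    by (rule nth_equalityI) (auto simp: hd_drop_conv_nth split: if_splits)
  ultimately show ?thesis by simp
qed

lemma computable_mism: "computable f \<Longrightarrow> computable g \<Longrightarrow> computable (\<lambda>x. mism (f x) (g x))"
  unfolding mism_def by (intro computable_intros computable_zip)

text \<open>The bound of \<open>complexity_le_log_card\<close> in the form in which it is applied: if all parameters are linear in
\<open>n\<close>, then the headers cost \<open>O(sqrt n)\<close> bits.\<close>

lemma complexity_upper_bound:
  fixes B :: "nat \<Rightarrow> bool list \<Rightarrow> bool list \<Rightarrow> bool"
  assumes U: "optimal_prefix_free_machine U"
    and B: "ce (\<lambda>z. B (fst (fst z)) (snd (fst z)) (snd z))"
  obtains c :: real where "\<And>a p \<beta> \<tau> n. B a p \<tau> \<Longrightarrow> finite {\<tau>. B a p \<tau>} \<Longrightarrow> real (card {\<tau>. B a p \<tau>}) \<le> 2 powr \<beta> \<Longrightarrow>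
    0 \<le> \<beta> \<Longrightarrow> a \<le> 2 * n \<Longrightarrow> length p \<le> 2 * n \<Longrightarrow> \<beta> + 1 \<le> 2 * real n \<Longrightarrow>
    \<exists>k. complexity U \<tau> = enat k \<and> real k \<le> real (length p) + \<beta> + 6 * sqrt (real n) + c"
proof -
  obtain c :: nat where c: "\<And>a p b \<tau>. B a p \<tau> \<Longrightarrow> finite {\<tau>. B a p \<tau>} \<Longrightarrow> card {\<tau>. B a p \<tau>} \<le> 2 ^ b \<Longrightarrow>
    complexity U \<tau> \<le> enat (length p + b + length (header a) + length (header (length p)) + length (header b) + c)"
    using complexity_le_log_card[OF U B] by blast
  show ?thesis
  proof (rule that[of "real c + 7"])
    fix a p \<beta> \<tau> n
    assume *: "B a p \<tau>" "finite {\<tau>. B a p \<tau>}" "real (card {\<tau>. B a p \<tau>}) \<le> 2 powr \<beta>" "0 \<le> \<beta>"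
      and le: "a \<le> 2 * n" "length p \<le> 2 * n" "\<beta> + 1 \<le> 2 * real n"
    define b where "b = nat \<lceil>\<beta>\<rceil>"
    have b: "\<beta> \<le> real b" "real b \<le> \<beta> + 1" using *(4) unfolding b_def by linarith+
    have "real (card {\<tau>. B a p \<tau>}) \<le> 2 powr real b"
      using *(3) b(1) by (meson order_trans powr_mono one_le_numeral)
    hence "real (card {\<tau>. B a p \<tau>}) \<le> real (2 ^ b)" by (simp add: powr_realpow)
    hence "card {\<tau>. B a p \<tau>} \<le> 2 ^ b" by (simp only: of_nat_le_iff)
    from c[OF *(1,2) this]
    obtain k where k: "complexity U \<tau> = enat k"
      "k \<le> length p + b + length (header a) + length (header (length p)) + length (header b) + c"
      by (cases "complexity U \<tau>") auto
    have hdr: "real (length (header m)) \<le> 2 + 2 * sqrt (real n)" if "m \<le> 2 * n" for m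
    proof -
      have "sqrt (2 * real m) \<le> sqrt (4 * real n)" using that by simp
      also have "\<dots> = 2 * sqrt (real n)" by (simp add: real_sqrt_mult)
      finally show ?thesis using length_header[of m] by simp
    qed
    have "real b \<le> real (2 * n)" using b(2) le(3) by simp
    hence "b \<le> 2 * n" by (simp only: of_nat_le_iff)
    have "real k \<le> real (length p + b + length (header a) + length (header (length p)) + length (header b) + c)"
      using k(2) by (simp only: of_nat_le_iff)
    also have "\<dots> \<le> real (length p) + \<beta> + 6 * sqrt (real n) + (real c + 7)"
      using hdr[OF le(1)] hdr[OF le(2)] hdr[OF \<open>b \<le> 2 * n\<close>] b(2) by simp
    finally show "\<exists>k. complexity U \<tau> = enat k \<and> real k \<le> real (length p) + \<beta> + 6 * sqrt (real n) + (real c + 7)"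
      using k(1) by blast
  qed
qed

lemma complexity_le_length:
  assumes U: "optimal_prefix_free_machine U"
  obtains c :: real where "\<And>\<tau>. \<tau> \<noteq> [] \<Longrightarrow> \<exists>k. complexity U \<tau> = enat k \<and> real k \<le> real (length \<tau>) + 6 * sqrt (real (length \<tau>)) + c"
proof -
  have "ce (\<lambda>z :: (nat \<times> bool list) \<times> bool list. snd z = snd (fst z))"
    by (intro ce_computable computable_intros)
  from complexity_upper_bound[OF U this]
  obtain c :: real where c: "\<And>a p \<beta> \<tau> n. \<tau> = p \<Longrightarrow> finite {\<tau>. \<tau> = p} \<Longrightarrow> real (card {\<tau>. \<tau> = p}) \<le> 2 powr \<beta> \<Longrightarrow>
    0 \<le> \<beta> \<Longrightarrow> a \<le> 2 * n \<Longrightarrow> length p \<le> 2 * n \<Longrightarrow> \<beta> + 1 \<le> 2 * real n \<Longrightarrow>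
    \<exists>k. complexity U \<tau> = enat k \<and> real k \<le> real (length p) + \<beta> + 6 * sqrt (real n) + c" by blast
  show ?thesis
  proof (rule that[of c])
    fix \<tau> :: "bool list" assume "\<tau> \<noteq> []"
    hence "1 \<le> length \<tau>" by (cases \<tau>) auto
    thus "\<exists>k. complexity U \<tau> = enat k \<and> real k \<le> real (length \<tau>) + 6 * sqrt (real (length \<tau>)) + c"
      using c[of \<tau> \<tau> 0 0 "length \<tau>"] by simp
  qed
qed

lemma eventually_sqrt_le_linear:
  assumes "\<delta> > 0" shows "\<forall>\<^sub>F n in sequentially. c + b * sqrt (real n) \<le> \<delta> * real n"
proof -
  have "(\<lambda>n. c * (1 / real n) + b * (1 / sqrt (real n))) \<longlonglongrightarrow> c * 0 + b * 0"
    by (intro tendsto_intros lim_1_over_n tendsto_divide_0[OF tendsto_const]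
        filterlim_at_top_imp_at_infinity filterlim_compose[OF sqrt_at_top filterlim_real_sequentially])
  hence "\<forall>\<^sub>F n in sequentially. c * (1 / real n) + b * (1 / sqrt (real n)) < \<delta>"
    by (rule order_tendstoD) (use assms in simp)
  thus ?thesis
    using eventually_gt_at_top[of 0]
  proof eventually_elim
    case (elim n)
    hence "(c * (1 / real n) + b * (1 / sqrt (real n))) * real n \<le> \<delta> * real n" by (intro mult_right_mono) auto
    moreover have "b * (1 / sqrt (real n)) * real n = b * sqrt (real n)"
      using elim(2) real_div_sqrt[of "real n"] by (simp flip: times_divide_eq_right)
    ultimately show ?case using elim(2) by (simp add: distrib_right)
  qed
qed

lemma length_seq_prefix [simp]: "length (seq_prefix X n) = n"
  by (simp add: seq_prefix_def)

lemma take_seq_prefix [simp]: "take m (seq_prefix X n) = seq_prefix X (min m n)"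
  by (simp add: seq_prefix_def take_map min_def)

text \<open>Since every string has a description that is longer by a sublinear amount only, the dimension never exceeds \<open>1\<close>.
So dimension one is a condition on lower bounds alone.\<close>

lemma effective_dim_eq_1_iff:
  assumes U: "optimal_prefix_free_machine U"
  shows "effective_dim U X = 1 \<longleftrightarrow> (\<forall>\<delta>>0. \<forall>\<^sub>F n in sequentially. \<forall>k.
    complexity U (seq_prefix X n) = enat k \<longrightarrow> (1 - \<delta>) * real n \<le> real k)"
proof -
  let ?K = "\<lambda>n. complexity U (seq_prefix X n)"
  obtain c :: real where c: "\<And>\<tau>. \<tau> \<noteq> [] \<Longrightarrow> \<exists>k. complexity U \<tau> = enat k \<and> real k \<le> real (length \<tau>) + 6 * sqrt (real (length \<tau>)) + c"
    using complexity_le_length[OF U] by blast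
  have fin: "\<exists>k. ?K n = enat k \<and> real k \<le> real n + 6 * sqrt (real n) + c" if "n > 0" for n
  proof -
    have "length (seq_prefix X n) = n" by simp
    hence "seq_prefix X n \<noteq> []" using that by force
    from c[OF this] show ?thesis by simp
  qed
  have "\<forall>\<^sub>F n in sequentially. y > ereal_of_enat (?K n) / ereal (real n)" if y: "y > 1" for y
  proof -
    obtain r where r: "1 < ereal r" "ereal r < y" using ereal_dense2[OF y] by auto
    hence "r - 1 > 0" by simp
    from eventually_sqrt_le_linear[OF this, of c 6] eventually_gt_at_top[of 0]
    show ?thesis
    proof eventually_elim
      case (elim n)
      obtain k where k: "?K n = enat k" "real k \<le> real n + 6 * sqrt (real n) + c" using fin elim(2) by blast
      have "real k \<le> r * real n" using k(2) elim(1) by (simp add: algebra_simps)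
      hence "real k / real n \<le> r" using elim(2) by (simp add: field_simps)
      hence "ereal (real k / real n) \<le> ereal r" by simp
      hence "ereal (real k / real n) < y" using r(2) by (rule le_less_trans)
      thus ?case using elim(2) by (simp add: k(1))
    qed
  qed
  hence "limsup (\<lambda>n. ereal_of_enat (?K n) / ereal (real n)) \<le> 1"
    unfolding Limsup_le_iff by blast
  hence le: "effective_dim U X \<le> 1"
    unfolding effective_dim_def using Liminf_le_Limsup[of sequentially] order_trans by fastforce
  have "effective_dim U X = 1 \<longleftrightarrow> 1 \<le> effective_dim U X" using le by auto
  also have "\<dots> \<longleftrightarrow> (\<forall>y<1. \<forall>\<^sub>F n in sequentially. y < ereal_of_enat (?K n) / ereal (real n))"
    unfolding effective_dim_def le_Liminf_iff ..
  also have "\<dots> \<longleftrightarrow> (\<forall>\<delta>>0. \<forall>\<^sub>F n in sequentially. \<forall>k. ?K n = enat k \<longrightarrow> (1 - \<delta>) * real n \<le> real k)"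
  proof (intro iffI allI impI)
    fix \<delta> :: real
    assume *: "\<forall>y<1. \<forall>\<^sub>F n in sequentially. y < ereal_of_enat (?K n) / ereal (real n)" and \<delta>: "\<delta> > 0"
    have "ereal (1 - \<delta>) < 1" using \<delta> by simp
    with * have "\<forall>\<^sub>F n in sequentially. ereal (1 - \<delta>) < ereal_of_enat (?K n) / ereal (real n)" by blast
    with eventually_gt_at_top[of 0]
    show "\<forall>\<^sub>F n in sequentially. \<forall>k. ?K n = enat k \<longrightarrow> (1 - \<delta>) * real n \<le> real k"
      by eventually_elim (auto simp: field_simps)
  next
    fix y :: ereal
    assume *: "\<forall>\<delta>>0. \<forall>\<^sub>F n in sequentially. \<forall>k. ?K n = enat k \<longrightarrow> (1 - \<delta>) * real n \<le> real k" and y: "y < 1"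
    obtain r where r: "y < ereal r" "ereal r < 1" using ereal_dense2[OF y] by auto
    hence "1 - r > 0" by simp
    with * have "\<forall>\<^sub>F n in sequentially. \<forall>k. ?K n = enat k \<longrightarrow> (1 - (1 - r)) * real n \<le> real k" by blast
    with eventually_gt_at_top[of 0]
    show "\<forall>\<^sub>F n in sequentially. y < ereal_of_enat (?K n) / ereal (real n)"
    proof eventually_elim
      case (elim n)
      obtain k where k: "?K n = enat k" using fin elim(1) by blast
      have "r \<le> real k / real n" using elim k by (simp add: field_simps)
      hence "ereal r \<le> ereal (real k / real n)" by simp
      with r(1) have "y < ereal (real k / real n)" by (rule less_le_trans)
      thus ?case using elim(1) by (simp add: k)
    qed
  qed
  finally show ?thesis .
qed

lemma seq_dist_eq_0_iff:
  "seq_dist X Y = 0 \<longleftrightarrow> (\<forall>\<epsilon>>0. \<forall>\<^sub>F n in sequentially. real (mism (seq_prefix X n) (seq_prefix Y n)) \<le> \<epsilon> * real n)"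
proof -
  let ?m = "\<lambda>n. real (mism (seq_prefix X n) (seq_prefix Y n))"
  have eq: "hamming_dist (seq_prefix X n) (seq_prefix Y n) = ?m n / real n" for n
    by (simp add: hamming_dist_eq_mism)
  have "0 \<le> liminf (\<lambda>n. ereal (?m n / real n))"
    by (rule Liminf_bounded) simp
  hence "0 \<le> seq_dist X Y"
    unfolding seq_dist_def eq using Liminf_le_Limsup[of sequentially] order_trans by fastforce
  hence "seq_dist X Y = 0 \<longleftrightarrow> seq_dist X Y \<le> 0" by auto
  also have "\<dots> \<longleftrightarrow> (\<forall>y>0. \<forall>\<^sub>F n in sequentially. y > ereal (?m n / real n))"
    unfolding seq_dist_def eq Limsup_le_iff ..
  also have "\<dots> \<longleftrightarrow> (\<forall>\<epsilon>>0. \<forall>\<^sub>F n in sequentially. ?m n \<le> \<epsilon> * real n)"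
  proof (intro iffI allI impI)
    fix \<epsilon> :: real assume *: "\<forall>y>0. \<forall>\<^sub>F n in sequentially. y > ereal (?m n / real n)" and \<epsilon>: "\<epsilon> > 0"
    have "\<forall>\<^sub>F n in sequentially. ereal \<epsilon> > ereal (?m n / real n)" using * \<epsilon> by (simp only: ereal_less)
    with eventually_gt_at_top[of 0] show "\<forall>\<^sub>F n in sequentially. ?m n \<le> \<epsilon> * real n"
      by eventually_elim (simp add: field_simps)
  next
    fix y :: ereal assume *: "\<forall>\<epsilon>>0. \<forall>\<^sub>F n in sequentially. ?m n \<le> \<epsilon> * real n" and y: "y > 0"
    obtain r where r: "0 < ereal r" "ereal r < y" using ereal_dense2[OF y] by auto
    hence "\<forall>\<^sub>F n in sequentially. ?m n \<le> r * real n" using * by simp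
    with eventually_gt_at_top[of 0] show "\<forall>\<^sub>F n in sequentially. y > ereal (?m n / real n)"
    proof eventually_elim
      case (elim n)
      hence "ereal (?m n / real n) \<le> ereal r" by (simp add: field_simps)
      thus ?case using r(2) by (rule le_less_trans)
    qed
  qed
  finally show ?thesis .
qed

section \<open>Sequences close to random ones have dimension one\<close>

lemma complexity_eq_enatE:
  assumes "complexity U \<tau> = enat k" obtains \<rho> where "U \<rho> = Some \<tau>" "length \<rho> = k"
proof -
  let ?A = "(\<lambda>\<sigma>. enat (length \<sigma>)) ` {\<sigma>. U \<sigma> = Some \<tau>}"
  have "Inf ?A = enat k" using assms by (simp add: complexity_def)
  moreover from this obtain a where "a \<in> ?A" by (cases "?A = {}") (auto simp: Inf_enat_def)
  hence "(LEAST x. x \<in> ?A) \<in> ?A" by (rule LeastI)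
  ultimately have "enat k \<in> ?A" unfolding Inf_enat_def by (simp split: if_splits)
  thus ?thesis using that by auto
qed

text \<open>The prefix of \<open>Y\<close> is described by a shortest program for the prefix of \<open>X\<close> and its position in a Hamming ball
of radius \<open>n/s\<^sup>2\<close>, where \<open>s\<close> depends on \<open>\<delta>\<close> only.\<close>

theorem effective_dim_eq_1_if_close_to_random:
  assumes U: "optimal_prefix_free_machine U" and Y: "martin_loef_random U Y" and XY: "seq_dist X Y = 0"
  shows "effective_dim U X = 1"
  unfolding effective_dim_eq_1_iff[OF U]
proof (intro allI impI)
  fix \<delta> :: real assume \<delta>: "\<delta> > 0"
  define B where "B a p \<tau> \<longleftrightarrow> (\<exists>x. U p = Some x \<and> length \<tau> = length x \<and> a * a * mism x \<tau> \<le> length x)" for a p \<tau>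
  have "ce (\<lambda>z. U (fst z) = Some (snd z))"
    using U by (simp add: optimal_prefix_free_machine_def prefix_free_machine_def partial_computable_iff_ce_graph)
  note U_ce = ce_comp[OF this computable_Pair, simplified]
  have "ce (\<lambda>z. B (fst (fst z)) (snd (fst z)) (snd z))"
    unfolding B_def by (intro ce_intros U_ce ce_computable computable_intros computable_mism)
  from complexity_upper_bound[OF U this]
  obtain c where c: "\<And>a p \<beta> \<tau> n. B a p \<tau> \<Longrightarrow> finite {\<tau>. B a p \<tau>} \<Longrightarrow> real (card {\<tau>. B a p \<tau>}) \<le> 2 powr \<beta> \<Longrightarrow>
    0 \<le> \<beta> \<Longrightarrow> a \<le> 2 * n \<Longrightarrow> length p \<le> 2 * n \<Longrightarrow> \<beta> + 1 \<le> 2 * real n \<Longrightarrow>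
    \<exists>k. complexity U \<tau> = enat k \<and> real k \<le> real (length p) + \<beta> + 6 * sqrt (real n) + c" by blast
  obtain c0 where c0: "\<And>n. enat n \<le> complexity U (seq_prefix Y n) + enat c0"
    using Y unfolding martin_loef_random_def by blast
  obtain s0 :: nat where s0: "8 / \<delta> \<le> real s0" using real_arch_simple by blast
  define s where "s = s0 + 4"
  have s: "s \<ge> 4" "4 / real s \<le> \<delta> / 2" using s0 \<delta> by (auto simp: s_def field_simps)
  have "1 / real (s * s) > 0" using s by simp
  hence "\<forall>\<^sub>F n in sequentially. real (mism (seq_prefix X n) (seq_prefix Y n)) \<le> 1 / real (s * s) * real n"
    using XY unfolding seq_dist_eq_0_iff by blast
  moreover have "\<forall>\<^sub>F n in sequentially. (real c0 + c) + 6 * sqrt (real n) \<le> \<delta> / 2 * real n"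
    using \<delta> by (intro eventually_sqrt_le_linear) simp
  ultimately show "\<forall>\<^sub>F n in sequentially. \<forall>k. complexity U (seq_prefix X n) = enat k \<longrightarrow> (1 - \<delta>) * real n \<le> real k"
    using eventually_ge_at_top[of "s + 1"]
  proof eventually_elim
    case (elim n)
    show ?case
    proof (intro allI impI)
      fix k assume k: "complexity U (seq_prefix X n) = enat k"
      then obtain \<rho> where \<rho>: "U \<rho> = Some (seq_prefix X n)" "length \<rho> = k" by (rule complexity_eq_enatE)
      have npos: "real n > 0" using elim(3) by simp
      show "(1 - \<delta>) * real n \<le> real k"
      proof (cases "k \<le> 2 * n")
        case True
        have "real (s * s * mism (seq_prefix X n) (seq_prefix Y n)) \<le> real n"
          using elim(1) s(1) by (simp add: field_simps)
        hence "s * s * mism (seq_prefix X n) (seq_prefix Y n) \<le> n" by (simp only: of_nat_le_iff)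
        hence BY: "B s \<rho> (seq_prefix Y n)" using \<rho> by (simp add: B_def)
        have ball: "{\<tau>. B s \<rho> \<tau>} = {\<tau>. length \<tau> = length (seq_prefix X n) \<and>
            s * s * mism (seq_prefix X n) \<tau> \<le> length (seq_prefix X n)}"
          using \<rho> by (auto simp: B_def)
        have fin: "finite {\<tau>. B s \<rho> \<tau>}" unfolding ball
          by (rule finite_subset[OF _ finite_strings[of n]]) auto
        have card: "real (card {\<tau>. B s \<rho> \<tau>}) \<le> 2 powr (4 * real n / real s)"
          unfolding ball using card_hamming_ball[of s "seq_prefix X n"] s(1) by simp
        have "4 * real n / real s \<le> real n" using s(1) npos by (simp add: field_simps)
        moreover have "1 \<le> real n" using elim(3) by simp
        ultimately have "4 * real n / real s + 1 \<le> 2 * real n" by linarith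
        with c[OF BY fin card, of n] True elim(3) \<rho>(2)
        obtain k' where k': "complexity U (seq_prefix Y n) = enat k'"
          "real k' \<le> real k + 4 * real n / real s + 6 * sqrt (real n) + c" by auto
        have "n \<le> k' + c0" using c0[of n] k'(1) by simp
        hence "real n \<le> real k' + real c0" by linarith
        also have "4 * real n / real s \<le> \<delta> / 2 * real n"
          using mult_right_mono[OF s(2), of "real n"] by simp
        ultimately have "real n \<le> real k + \<delta> * real n"
          using k'(2) elim(2) by linarith
        thus ?thesis by (simp add: algebra_simps)
      next
        case False
        hence "real n \<le> real k" by simp
        moreover have "(1 - \<delta>) * real n \<le> 1 * real n" using \<delta> by (intro mult_right_mono) auto
        ultimately show ?thesis by simp
      qed
    qed
  qed
qed

section \<open>Block decompositions\<close>

text \<open>A list \<open>h\<close> of bits, latest bit first, encodes a decomposition of an initial segment of the positions into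
blocks, one block for each bit. The number \<open>k\<close> that governs block length and admitted distance is called the
stage; a bit \<open>True\<close> raises it by one. The relative length \<open>1/k\<close> makes the last, incomplete block
negligible for the limit of the distances. The summand \<open>2 * length h + 1\<close> ensures that \<open>j\<close> blocks cover
at least \<open>j\<^sup>2\<close> positions, so that \<open>h\<close> costs only a sublinear number of bits.\<close>

primrec stage :: "bool list \<Rightarrow> nat" where
  "stage [] = 1"
| "stage (b # h) = stage h + of_bool b"

primrec offset :: "bool list \<Rightarrow> nat" where
  "offset [] = 0"
| "offset (b # h) = offset h + (offset h div stage (b # h) + 2 * length h + 1)"

definition block_length :: "bool list \<Rightarrow> nat" where
  "block_length h = offset h - offset (tl h)"

definition block :: "bool list \<Rightarrow> bool list \<Rightarrow> bool list" where
  "block h x = drop (offset (tl h)) (take (offset h) x)"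

text \<open>On each block, the strings differ in at most a fraction of one over the stage of that block. The suffixes
\<open>drop i h\<close> are the decompositions that end with the earlier blocks.\<close>

definition close :: "bool list \<Rightarrow> bool list \<Rightarrow> bool list \<Rightarrow> bool" where
  "close h x y \<longleftrightarrow> (\<forall>i\<in>set [0..<length h].
     stage (drop i h) * mism (block (drop i h) x) (block (drop i h) y) \<le> block_length (drop i h))"

lemma stage_pos: "0 < stage h" by (induction h) auto

lemma block_length_Cons: "block_length (b # h) = offset h div stage (b # h) + 2 * length h + 1"
  by (simp add: block_length_def)

lemma offset_Cons: "offset (b # h) = offset h + block_length (b # h)"
  by (simp add: block_length_def)

lemma offset_drop_le: "offset (drop i h) \<le> offset h"
proof (induction h arbitrary: i)
  case (Cons b h)
  from Cons.IH[of "i - 1"] show ?case by (cases i) auto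
qed simp

lemma stage_drop_le: "stage (drop i h) \<le> stage h"
proof (induction h arbitrary: i)
  case (Cons b h)
  from Cons.IH[of "i - 1"] show ?case by (cases i) auto
qed simp

lemma length_square_le_offset: "length h * length h \<le> offset h"
  by (induction h) auto

lemma length_le_offset: "length h \<le> offset h"
  using length_square_le_offset[of h] by (meson le_square order_trans)

text \<open>A block is a fraction of at least \<open>1/(k+1)\<close> of everything up to its end, so compressing the block by a constant
factor compresses the whole prefix by a constant factor.\<close>

lemma offset_le_block_length: "offset (b # h) \<le> (stage (b # h) + 1) * block_length (b # h)"
proof -
  define k where "k = stage (b # h)"
  have k: "k > 0" unfolding k_def by (rule stage_pos)
  have "offset h = k * (offset h div k) + offset h mod k" by simp
  also have "\<dots> \<le> k * (offset h div k) + k" using k by (intro add_left_mono less_imp_le) simp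
  also have "\<dots> \<le> k * block_length (b # h)" unfolding block_length_Cons k_def by simp
  finally show ?thesis unfolding offset_Cons k_def by simp
qed

lemma close_Nil [simp]: "close [] x y" by (simp add: close_def)

lemma close_Cons: "close (b # h) x y \<longleftrightarrow>
  stage (b # h) * mism (block (b # h) x) (block (b # h) y) \<le> block_length (b # h) \<and> close h x y"
proof -
  have "[0..<length (b # h)] = 0 # map Suc [0..<length h]"
    by (simp add: upt_conv_Cons map_Suc_upt del: upt_Suc)
  hence "set [0..<length (b # h)] = insert 0 (Suc ` set [0..<length h])"
    by (simp only: list.set set_map)
  thus ?thesis unfolding close_def by (simp only: ball_simps drop_0 drop_Suc_Cons)
qed

lemma close_drop:
  assumes "close h x y" shows "close (drop i h) x y"
  using assms unfolding close_def
  by (auto simp: drop_drop less_diff_conv add.commute)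

lemma block_take: "offset h \<le> n \<Longrightarrow> block h (take n x) = block h x"
  by (simp add: block_def min_absorb1)

lemma close_take:
  assumes "offset h \<le> m" "offset h \<le> n"
  shows "close h (take m x) (take n y) \<longleftrightarrow> close h x y"
proof -
  have "offset (drop i h) \<le> m" "offset (drop i h) \<le> n" for i
    using offset_drop_le[of i h] assms by auto
  thus ?thesis by (simp add: close_def block_take)
qed

lemma computable_take:
  assumes "computable n" "computable f" shows "computable (\<lambda>x. take (n x) (f x))"
proof -
  have "computable (\<lambda>x. map (\<lambda>i. hd (drop i (f x))) [0..<if n x \<le> length (f x) then n x else length (f x)])"
    by (intro computable_intros assms computable_comp[OF assms(2)])
  moreover have "map (\<lambda>i. hd (drop i u)) [0..<if m \<le> length u then m else length u] = take m u" for u :: "'b list" and m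
    by (rule nth_equalityI) (auto simp: hd_drop_conv_nth split: if_splits)
  ultimately show ?thesis by simp
qed

lemma computable_stage_offset:
  assumes "computable f"
  shows computable_stage: "computable (\<lambda>x. stage (f x))" and computable_offset: "computable (\<lambda>x. offset (f x))"
proof -
  let ?step = "\<lambda>b s. (fst s + (fst s div (fst (snd s) + of_bool b) + 2 * snd (snd s) + 1),
      fst (snd s) + of_bool b, Suc (snd (snd s)))"
  have *: "computable (\<lambda>x. foldr (\<lambda>b s. ?step b s) (f x) (0, 1, 0))"
    by (intro computable_foldr computable_intros assms)
  \<comment> \<open>offset, stage and number of blocks are computed together\<close>
  have eq: "foldr (\<lambda>b s. ?step b s) h (0, 1, 0) = (offset h, stage h, length h)" for h
    by (induction h) simp_all
  show "computable (\<lambda>x. stage (f x))" "computable (\<lambda>x. offset (f x))"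
    using computable_fst[OF *] computable_fst[OF computable_snd[OF *]] by (simp_all only: eq fst_conv snd_conv)
qed

lemmas computable_block_intros = computable_stage computable_offset computable_take computable_mism

lemma computable_block_length: "computable f \<Longrightarrow> computable (\<lambda>x. block_length (f x))"
  unfolding block_length_def by (intro computable_intros computable_block_intros)

lemma computable_close:
  assumes "computable f" "computable g" "computable h" shows "computable (\<lambda>x. close (f x) (g x) (h x))"
  unfolding close_def block_length_def block_def
  by (intro computable_intros computable_block_intros assms computable_comp[OF assms(1)]
      computable_comp[OF assms(2)] computable_comp[OF assms(3)])

section \<open>The set of unapproachable blocks is enumerable\<close>

lemma ce_compressible:
  assumes "ce (\<lambda>z. U (fst z) = Some (snd z))" "computable f" shows "ce (\<lambda>x. compressible U (f x))"
proof -
  note U_ce = ce_comp[OF assms(1) computable_Pair, simplified]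
  have "ce (\<lambda>z. \<exists>\<rho> \<tau> w. U \<rho> = Some \<tau> \<and> length \<rho> < length \<tau> \<and> z = \<tau> @ w)"
    by (intro ce_intros U_ce ce_computable computable_intros)
  hence "ce (\<lambda>z. compressible U z)" by (simp add: compressible_def prefix_def)
  from ce_comp[OF this assms(2)] show ?thesis .
qed

text \<open>That too few extensions are incompressible is witnessed by a list of sufficiently many compressible ones.
The inequality is rearranged to avoid subtraction.\<close>

lemma not_good_iff: "\<not> good U q y \<longleftrightarrow> (\<exists>N L. distinct L \<and> (\<forall>w\<in>set L. length w = N \<and> compressible U (y @ w)) \<and>
    2 ^ N * 2 ^ q < 2 ^ N + length L * 2 ^ q)"
proof -
  define C where "C N = {w \<in> strings N. compressible U (y @ w)}" for N
  have finC: "finite (C N)" "C N \<subseteq> strings N" for N by (auto simp: C_def finite_strings)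
  have "card (incompressible_exts U y N) + card (C N) = 2 ^ N" for N
  proof -
    have "card (incompressible_exts U y N \<union> C N) = card (incompressible_exts U y N) + card (C N)"
      by (rule card_Un_disjoint[OF finite_incompressible_exts finC(1)]) (auto simp: incompressible_exts_def C_def)
    moreover have "incompressible_exts U y N \<union> C N = strings N"
      by (auto simp: incompressible_exts_def C_def)
    ultimately show ?thesis by (simp add: card_strings)
  qed
  hence eq: "card (incompressible_exts U y N) * 2 ^ q + card (C N) * 2 ^ q = 2 ^ N * 2 ^ q" for N
    by (metis add_mult_distrib)
  have "\<not> good U q y \<longleftrightarrow> (\<exists>N. 2 ^ N * 2 ^ q < 2 ^ N + card (C N) * 2 ^ q)"
    unfolding good_def eq[symmetric] by (auto simp: not_le)
  also have "\<dots> \<longleftrightarrow> (\<exists>N L. distinct L \<and> set L \<subseteq> C N \<and> 2 ^ N * 2 ^ q < 2 ^ N + length L * 2 ^ q)"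
  proof (intro ex_cong1 iffI)
    fix N assume *: "2 ^ N * 2 ^ q < 2 ^ N + card (C N) * 2 ^ q"
    obtain L where "set L = C N" "distinct L" using finite_distinct_list[OF finC(1)] by blast
    thus "\<exists>L. distinct L \<and> set L \<subseteq> C N \<and> 2 ^ N * 2 ^ q < 2 ^ N + length L * 2 ^ q"
      using * distinct_card[of L] by (intro exI[of _ L]) auto
  next
    fix N assume "\<exists>L. distinct L \<and> set L \<subseteq> C N \<and> 2 ^ N * 2 ^ q < 2 ^ N + length L * 2 ^ q"
    then obtain L where L: "distinct L" "set L \<subseteq> C N" "2 ^ N * 2 ^ q < 2 ^ N + length L * 2 ^ q" by blast
    have "length L \<le> card (C N)" using card_mono[OF finC(1) L(2)] distinct_card[OF L(1)] by simp
    hence "length L * 2 ^ q \<le> card (C N) * 2 ^ q" by simp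
    thus "2 ^ N * 2 ^ q < 2 ^ N + card (C N) * 2 ^ q" using L(3) by linarith
  qed
  also have "\<dots> \<longleftrightarrow> (\<exists>N L. distinct L \<and> (\<forall>w\<in>set L. length w = N \<and> compressible U (y @ w)) \<and>
    2 ^ N * 2 ^ q < 2 ^ N + length L * 2 ^ q)"
    by (simp add: C_def subset_eq)
  finally show ?thesis .
qed

lemma ce_not_good:
  assumes U: "ce (\<lambda>z. U (fst z) = Some (snd z))" and "computable f" "computable g"
  shows "ce (\<lambda>x. \<not> good U (f x) (g x))"
  unfolding not_good_iff
  by (intro ce_intros ce_compressible[OF U] ce_computable computable_intros
      computable_comp[OF assms(2)] computable_comp[OF assms(3)])

text \<open>The parameter \<open>p\<close> consists of the schedule \<open>h\<close>, whose length is given by \<open>a\<close>, and the string \<open>x\<close> that precedes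
the last block. The relation holds if the last block \<open>x'\<close> of \<open>\<tau>\<close> is far from all good continuations of every
candidate \<open>y\<close>. A candidate found out not to be good is discarded; so no candidate has to be known.\<close>

definition unapproachable :: "(bool list \<rightharpoonup> bool list) \<Rightarrow> nat \<Rightarrow> bool list \<Rightarrow> bool list \<Rightarrow> bool" where
  "unapproachable U a p \<tau> \<longleftrightarrow> (\<exists>h x x'. p = h @ x \<and> length h = a \<and> length x = offset (tl h) \<and>
     length x' = block_length h \<and> \<tau> = x @ x' \<and>
     (\<forall>y\<in>set (List.n_lists (offset (tl h)) [False, True]). \<not> close (tl h) x y \<or> \<not> good U a y \<or>
       (\<forall>z\<in>set (List.n_lists (block_length h) [False, True]).
          block_length h < stage h * mism x' z \<or> \<not> good U (Suc a) (y @ z))))"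

lemma ce_unapproachable:
  assumes "ce (\<lambda>z. U (fst z) = Some (snd z))"
  shows "ce (\<lambda>z. unapproachable U (fst (fst z)) (snd (fst z)) (snd z))"
  unfolding unapproachable_def
  by (intro ce_intros ce_not_good[OF assms] ce_computable computable_intros computable_block_intros
      computable_block_length computable_close)

section \<open>Approaching a sequence of dimension one\<close>

text \<open>The string \<open>y\<close> is a candidate for the prefix of the random sequence: it satisfies the distance
conditions for all blocks of \<open>h\<close>, and each block has cost at most half of the measure.\<close>

definition candidate :: "(bool list \<rightharpoonup> bool list) \<Rightarrow> (nat \<Rightarrow> bool) \<Rightarrow> bool list \<Rightarrow> bool list \<Rightarrow> bool" where
  "candidate U X h y \<longleftrightarrow> length y = offset h \<and> close h (seq_prefix X (offset h)) y \<and> good U (Suc (length h)) y"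

lemma block_append:
  assumes "length x = offset h" "length x' = block_length (b # h)"
  shows "block (b # h) (x @ x') = x'"
  using assms by (simp add: block_def offset_Cons[of b h] del: offset.simps)

lemma candidate_Cons:
  assumes y: "candidate U X h y" and z: "length z = block_length (b # h)"
    and near: "stage (b # h) * mism (drop (offset h) (seq_prefix X (offset (b # h)))) z \<le> block_length (b # h)"
    and good: "good U (Suc (Suc (length h))) (y @ z)"
  shows "candidate U X (b # h) (y @ z)"
proof -
  have le: "offset h \<le> offset (b # h)" by simp
  have y': "length y = offset h" "close h (seq_prefix X (offset h)) y" using y by (auto simp: candidate_def)
  have "close h (take (offset h) (seq_prefix X (offset (b # h)))) (take (offset h) (y @ z))"
    using y' le by (simp add: min_absorb1 del: offset.simps)
  hence "close h (seq_prefix X (offset (b # h))) (y @ z)" unfolding close_take[OF order_refl order_refl] .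
  moreover have "block (b # h) (seq_prefix X (offset (b # h))) = drop (offset h) (seq_prefix X (offset (b # h)))"
    by (simp add: block_def del: offset.simps)
  ultimately show ?thesis
    using y' z near good block_append[OF y'(1) z]
    by (simp add: candidate_def close_Cons offset_Cons del: offset.simps stage.simps)
qed

lemma candidate_Nil: "prefix_free_machine U \<Longrightarrow> candidate U X [] []"
  using good_Nil by (simp add: candidate_def)

text \<open>At stage \<open>1\<close> the distance condition is void, so any good continuation will do.\<close>

lemma ex_candidate_Cons_stage_1:
  assumes "candidate U X h y" "stage (b # h) = 1"
  shows "\<exists>y. candidate U X (b # h) y"
proof -
  define l where "l = block_length (b # h)"
  have "good U (Suc (length h)) y" using assms by (simp add: candidate_def)
  from good_extensions[OF this, of l]
  have "card {z \<in> strings l. good U (Suc (Suc (length h))) (y @ z)} \<noteq> 0" by (intro notI) simp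
  hence "{z \<in> strings l. good U (Suc (Suc (length h))) (y @ z)} \<noteq> {}" by (metis card.empty)
  then obtain z where z: "length z = l" "good U (Suc (Suc (length h))) (y @ z)" by blast
  have "stage (b # h) * mism (drop (offset h) (seq_prefix X (offset (b # h)))) z \<le> block_length (b # h)"
    using mism_le[of _ z] z(1) assms(2) by (simp add: l_def)
  from candidate_Cons[OF assms(1) _ this] z show ?thesis by (auto simp: l_def)
qed

text \<open>The heart of the proof. If no candidate for \<open>b # h\<close> existed, then the prefix of \<open>X\<close> up to the end of the new
block would be a member of the enumerable set of unapproachable strings. Even one candidate \<open>y\<close> for \<open>h\<close> bounds the size
of this set, and the resulting description saves a constant fraction of the prefix. For large prefixes this
contradicts dimension one.\<close>

lemma ex_candidate_Cons:
  assumes U: "optimal_prefix_free_machine U" and X: "effective_dim U X = 1" and k: "k \<ge> 1"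
  shows "\<exists>N. \<forall>b h y. stage (b # h) = k \<longrightarrow> N \<le> offset h \<longrightarrow> candidate U X h y \<longrightarrow> (\<exists>y. candidate U X (b # h) y)"
proof -
  have "ce (\<lambda>z. U (fst z) = Some (snd z))"
    using U by (simp add: optimal_prefix_free_machine_def prefix_free_machine_def partial_computable_iff_ce_graph)
  from complexity_upper_bound[OF U ce_unapproachable[OF this]]
  obtain c where c: "\<And>a p \<beta> \<tau> n. unapproachable U a p \<tau> \<Longrightarrow> finite {\<tau>. unapproachable U a p \<tau>} \<Longrightarrow>
    real (card {\<tau>. unapproachable U a p \<tau>}) \<le> 2 powr \<beta> \<Longrightarrow>
    0 \<le> \<beta> \<Longrightarrow> a \<le> 2 * n \<Longrightarrow> length p \<le> 2 * n \<Longrightarrow> \<beta> + 1 \<le> 2 * real n \<Longrightarrow>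
    \<exists>k. complexity U \<tau> = enat k \<and> real k \<le> real (length p) + \<beta> + 6 * sqrt (real n) + c" by blast
  \<comment> \<open>\<open>\<gamma>\<close> is the fraction that is saved on the new block; on the entire prefix at least \<open>2 * \<delta>\<close> is saved\<close>
  define \<gamma> where "\<gamma> = 1 / (2 * real k * (real k + 1))"
  define \<delta> where "\<delta> = \<gamma> / (2 * (real k + 1))"
  have \<gamma>: "0 < \<gamma>" "\<gamma> \<le> 1"
  proof -
    have "1 * 1 \<le> (2 * real k) * (real k + 1)" using k by (intro mult_mono) auto
    thus "0 < \<gamma>" "\<gamma> \<le> 1" using k by (auto simp: \<gamma>_def field_simps)
  qed
  have \<delta>: "\<delta> > 0" using \<gamma> by (simp add: \<delta>_def)
  have "\<forall>\<^sub>F n in sequentially. (\<forall>j. complexity U (seq_prefix X n) = enat j \<longrightarrow> (1 - \<delta>) * real n \<le> real j) \<and>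
      (c + 2) + 8 * sqrt (real n) \<le> \<delta> * real n \<and> 4 \<le> n"
    using X \<delta> unfolding effective_dim_eq_1_iff[OF U]
    by (intro eventually_conj eventually_sqrt_le_linear eventually_ge_at_top) auto
  then obtain N where N: "\<And>n. n \<ge> N \<Longrightarrow> (\<forall>j. complexity U (seq_prefix X n) = enat j \<longrightarrow> (1 - \<delta>) * real n \<le> real j)"
      "\<And>n. n \<ge> N \<Longrightarrow> (c + 2) + 8 * sqrt (real n) \<le> \<delta> * real n" "\<And>n. n \<ge> N \<Longrightarrow> 4 \<le> n"
    unfolding eventually_sequentially by blast
  show ?thesis
  proof (intro exI[of _ N] allI impI, rule ccontr)
    fix b h y
    assume stage: "stage (b # h) = k" and le: "N \<le> offset h" and y: "candidate U X h y"
      and none: "\<nexists>y. candidate U X (b # h) y"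
    define l where "l = block_length (b # h)"
    define m where "m = offset h"
    define n where "n = offset (b # h)"
    define a where "a = length (b # h)"
    define x where "x = seq_prefix X m"
    define x' where "x' = drop m (seq_prefix X n)"
    have n: "n = m + l" unfolding n_def m_def l_def by (rule offset_Cons)
    have xx': "seq_prefix X n = x @ x'"
      using append_take_drop_id[of m "seq_prefix X n"] n by (simp add: x_def x'_def)
    have len: "length x = m" "length x' = l" by (auto simp: x_def x'_def n)
    have nge: "n \<ge> N" using le by (simp add: n m_def)
    have a_le: "a * a \<le> n" unfolding a_def n_def by (rule length_square_le_offset)
    have un: "unapproachable U a ((b # h) @ x) (x @ x')"
      unfolding unapproachable_def set_n_lists_bool
    proof (intro exI conjI ballI)
      fix y assume "y \<in> strings (offset (tl (b # h)))"
      hence "length y = m" by (simp add: m_def)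
      show "\<not> close (tl (b # h)) x y \<or> \<not> good U a y \<or>
         (\<forall>z\<in>strings (block_length (b # h)). block_length (b # h) < stage (b # h) * mism x' z \<or> \<not> good U (Suc a) (y @ z))"
      proof (cases "close h x y \<and> good U a y")
        case True
        hence y: "candidate U X h y" using \<open>length y = m\<close> by (simp add: candidate_def x_def m_def a_def)
        have "l < stage (b # h) * mism x' z \<or> \<not> good U (Suc a) (y @ z)" if "length z = l" for z
        proof (rule ccontr)
          assume "\<not> (l < stage (b # h) * mism x' z \<or> \<not> good U (Suc a) (y @ z))"
          hence "candidate U X (b # h) (y @ z)"
            using that by (intro candidate_Cons[OF y])
              (auto simp: l_def x'_def m_def n_def a_def not_less simp del: stage.simps offset.simps)
          thus False using none by blast
        qed
        thus ?thesis by (simp add: l_def del: stage.simps)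
      qed auto
    qed (auto simp: len a_def m_def l_def)
    define A where "A = {z \<in> strings l. good U (Suc a) (y @ z)}"
    have y': "length y = m" "close h x y" "good U a y"
      using y by (auto simp: candidate_def x_def m_def a_def)
    define F where "F = {x' \<in> strings l. \<forall>z\<in>A. l < k * mism x' z}"
    \<comment> \<open>\<open>p\<close> and \<open>a\<close> determine the schedule and the old part \<open>x\<close>, so the set is bounded by the one candidate \<open>y\<close>\<close>
    have sub: "{\<tau>. unapproachable U a ((b # h) @ x) \<tau>} \<subseteq> (\<lambda>u. x @ u) ` F"
    proof
      fix \<tau> assume "\<tau> \<in> {\<tau>. unapproachable U a ((b # h) @ x) \<tau>}"
      then obtain g w u where *: "(b # h) @ x = g @ w" "length g = a" "length w = offset (tl g)"
          "length u = block_length g" "\<tau> = w @ u"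
          "\<forall>y\<in>strings (offset (tl g)). \<not> close (tl g) w y \<or> \<not> good U a y \<or>
            (\<forall>z\<in>strings (block_length g). block_length g < stage g * mism u z \<or> \<not> good U (Suc a) (y @ z))"
        unfolding unapproachable_def set_n_lists_bool mem_Collect_eq by blast
      have gw: "g = b # h" "w = x" using *(1,2) append_eq_append_conv[of "b # h" g x w] by (auto simp: a_def)
      have "\<forall>z\<in>strings l. l < k * mism u z \<or> \<not> good U (Suc a) (y @ z)"
        using *(6)[unfolded gw, rule_format, of y] y' by (simp add: l_def m_def stage del: stage.simps)
      hence "u \<in> F" using *(4) by (auto simp: F_def A_def gw l_def)
      thus "\<tau> \<in> (\<lambda>u. x @ u) ` F" using *(5) gw by blast
    qed
    have finF: "finite F" by (simp add: F_def finite_strings)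
    have fin: "finite {\<tau>. unapproachable U a ((b # h) @ x) \<tau>}"
      using sub finF by (meson finite_imageI finite_subset)
    have "card {\<tau>. unapproachable U a ((b # h) @ x) \<tau>} \<le> card F"
      using card_mono[OF finite_imageI[OF finF] sub] card_image_le[OF finF] order_trans by blast
    moreover have "real (card F) \<le> 2 powr (real (Suc a) + real l - real l / (2 * real k * (real k + 1)))"
      unfolding F_def
    proof (rule card_far_from_large_set[OF _ _ k])
      show "2 ^ l \<le> card A * 2 ^ Suc a" unfolding A_def by (rule good_extensions[OF y'(3)])
    qed (auto simp: A_def)
    ultimately have card: "real (card {\<tau>. unapproachable U a ((b # h) @ x) \<tau>}) \<le> 2 powr (real (Suc a) + real l - real l * \<gamma>)"
      by (simp add: \<gamma>_def)
    have l\<gamma>: "real l * \<gamma> \<le> real l" "0 \<le> real l * \<gamma>" using mult_left_mono[OF \<gamma>(2), of "real l"] \<gamma> by simp_all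
    have "4 \<le> n" using N(3) nge by blast
    have a2: "a + 2 \<le> n"
    proof (cases "a \<le> 2")
      case True thus ?thesis using \<open>4 \<le> n\<close> by simp
    next
      case False
      hence "3 * a \<le> a * a" by simp
      thus ?thesis using a_le False by linarith
    qed
    have "a \<le> 2 * n" "length ((b # h) @ x) \<le> 2 * n" "real (Suc a) + real l - real l * \<gamma> + 1 \<le> 2 * real n" "0 \<le> real (Suc a) + real l - real l * \<gamma>"
      using a2 l\<gamma> n len by (auto simp: a_def)
    with c[OF un fin card, of n]
    obtain j where j: "complexity U (x @ x') = enat j"
      "real j \<le> real (length ((b # h) @ x)) + (real (Suc a) + real l - real l * \<gamma>) + 6 * sqrt (real n) + c" by blast
    have low: "(1 - \<delta>) * real n \<le> real j" using N(1)[OF nge] j(1) by (simp add: xx')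
    have up: "real j \<le> real n + 2 * real a + 1 - real l * \<gamma> + 6 * sqrt (real n) + c"
      using j(2) by (simp add: n len a_def)
    have a_sqrt: "real a \<le> sqrt (real n)"
    proof (rule real_le_rsqrt)
      have "real (a * a) \<le> real n" using a_le by (simp only: of_nat_le_iff)
      thus "(real a)\<^sup>2 \<le> real n" by (simp add: power2_eq_square)
    qed
    have "2 * \<delta> * real n \<le> real l * \<gamma>"
    proof -
      have "n \<le> (k + 1) * l" using offset_le_block_length[of b h] unfolding stage n_def l_def .
      hence "real n \<le> real ((k + 1) * l)" by (simp only: of_nat_le_iff)
      hence "2 * \<delta> * real n \<le> 2 * \<delta> * ((real k + 1) * real l)"
        using \<delta> by (intro mult_left_mono) (auto simp: algebra_simps)
      also have "\<dots> = real l * \<gamma>" using k by (simp add: \<delta>_def field_simps)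
      finally show ?thesis .
    qed
    moreover have "(1 - \<delta>) * real n = real n - \<delta> * real n" by (simp add: algebra_simps)
    ultimately have "\<delta> * real n < (c + 2) + 8 * sqrt (real n)" using low up a_sqrt by simp
    thus False using N(2)[OF nge] by simp
  qed
qed

section \<open>Passing to the limit\<close>

text \<open>Koenig's lemma: extend a prefix that is shared by infinitely many of the strings, bit by bit.\<close>

lemma koenig:
  fixes ys :: "nat \<Rightarrow> bool list"
  assumes len: "\<And>j. j \<le> length (ys j)"
  obtains Y where "\<And>n. infinite {j. take n (ys j) = seq_prefix Y n}"
proof -
  let ?P = "\<lambda>n w. infinite {j. take n (ys j) = w} \<and> length w = n"
  have "\<exists>f. \<forall>n. ?P n (f n) \<and> (\<exists>b. f (Suc n) = f n @ [b])"
  proof (rule dependent_nat_choice[of ?P "\<lambda>n w w'. \<exists>b. w' = w @ [b]"])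
    show "\<exists>w. ?P 0 w" by (intro exI[of _ "[]"]) simp
  next
    fix w n assume w: "?P n w"
    have "{j. take n (ys j) = w} \<subseteq> {..n} \<union> (\<Union>b. {j. take (Suc n) (ys j) = w @ [b]})"
    proof
      fix j assume j: "j \<in> {j. take n (ys j) = w}"
      show "j \<in> {..n} \<union> (\<Union>b. {j. take (Suc n) (ys j) = w @ [b]})"
      proof (cases "j \<le> n")
        case False
        hence "n < length (ys j)" using len[of j] by simp
        thus ?thesis using j by (auto simp: take_Suc_conv_app_nth)
      qed simp
    qed
    hence "infinite (\<Union>b. {j. take (Suc n) (ys j) = w @ [b]})"
      using w by (meson finite_Un finite_atMost finite_subset)
    then obtain b where "infinite {j. take (Suc n) (ys j) = w @ [b]}" by auto
    thus "\<exists>w'. ?P (Suc n) w' \<and> (\<exists>b. w' = w @ [b])" using w by (intro exI[of _ "w @ [b]"]) auto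
  qed
  then obtain f where f: "\<And>n. ?P n (f n)" "\<And>n. \<exists>b. f (Suc n) = f n @ [b]" by blast
  define Y where "Y n = last (f (Suc n))" for n
  have "f n = seq_prefix Y n" for n
  proof (induction n)
    case 0
    then show ?case using f(1)[of 0] by (simp add: seq_prefix_def)
  next
    case (Suc n)
    obtain b where "f (Suc n) = f n @ [b]" using f(2) by blast
    then show ?case using Suc by (simp add: seq_prefix_def Y_def)
  qed
  thus ?thesis using f(1) that[of Y] by metis
qed

lemma mism_seq_prefix_add:
  "mism (seq_prefix X (m + l)) (seq_prefix Y (m + l)) =
   mism (seq_prefix X m) (seq_prefix Y m) + mism (drop m (seq_prefix X (m + l))) (drop m (seq_prefix Y (m + l)))"
proof -
  have "seq_prefix Z (m + l) = seq_prefix Z m @ drop m (seq_prefix Z (m + l))" for Z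
    using append_take_drop_id[of m "seq_prefix Z (m + l)"] by simp
  thus ?thesis by (metis mism_append length_seq_prefix)
qed

text \<open>The schedule raises the stage to \<open>k + 1\<close> as soon as the prefix is long enough for \<open>ex_candidate_Cons\<close> at
that stage. The stages tend to infinity since the lengths do.\<close>

theorem ex_close_random_if_effective_dim_eq_1:
  assumes U: "optimal_prefix_free_machine U" and X: "effective_dim U X = 1"
  shows "\<exists>Y. martin_loef_random U Y \<and> seq_dist X Y = 0"
proof -
  have pf: "prefix_free_machine U" using U by (simp add: optimal_prefix_free_machine_def)
  have "\<exists>N. \<forall>k. k \<ge> 1 \<longrightarrow> (\<forall>b h y. stage (b # h) = k \<longrightarrow> N k \<le> offset h \<longrightarrow> candidate U X h y \<longrightarrow> (\<exists>y. candidate U X (b # h) y))"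
    using ex_candidate_Cons[OF U X] by (intro choice) auto
  then obtain N where N: "\<And>b h y. N (stage (b # h)) \<le> offset h \<Longrightarrow> candidate U X h y \<Longrightarrow> \<exists>y. candidate U X (b # h) y"
    using stage_pos by (metis One_nat_def Suc_leI)
  \<comment> \<open>\<open>N k\<close> is the length from which on candidates survive at stage \<open>k\<close>; \<open>hist j\<close> is the schedule of the first \<open>j\<close> blocks\<close>
  define hist where "hist = rec_nat [] (\<lambda>_ h. (N (Suc (stage h)) \<le> offset h) # h)"
  have hist_0: "hist 0 = []" and hist_Suc: "hist (Suc j) = (N (Suc (stage (hist j))) \<le> offset (hist j)) # hist j" for j
    by (simp_all add: hist_def)
  have length_hist: "length (hist j) = j" for j by (induction j) (simp_all add: hist_0 hist_Suc)
  have drop_hist: "drop i (hist (i + j)) = hist j" for i j by (induction i) (simp_all add: hist_Suc)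
  have offset_mono: "offset (hist i) \<le> offset (hist j)" if "i \<le> j" for i j
    using offset_drop_le[of "j - i" "hist j"] drop_hist[of "j - i" i] that by simp
  have stage_mono: "stage (hist i) \<le> stage (hist j)" if "i \<le> j" for i j
    using stage_drop_le[of "j - i" "hist j"] drop_hist[of "j - i" i] that by simp
  have le_offset: "j \<le> offset (hist j)" for j
    using length_le_offset[of "hist j"] length_hist by simp

  have "(\<exists>y. candidate U X (hist j) y) \<and> (stage (hist j) = 1 \<or> N (stage (hist j)) \<le> offset (hist j))" for j
  proof (induction j)
    case 0
    then show ?case using candidate_Nil[OF pf] by (auto simp: hist_0)
  next
    case (Suc j)
    then obtain y where y: "candidate U X (hist j) y" by blast
    have le: "offset (hist j) \<le> offset (hist (Suc j))" by (rule offset_mono) simp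
    show ?case
    proof (cases "stage (hist (Suc j)) = 1")
      case True
      then show ?thesis using ex_candidate_Cons_stage_1[OF y] by (simp only: hist_Suc) blast
    next
      case False
      have N_le: "N (stage (hist (Suc j))) \<le> offset (hist j)"
      proof (cases "N (Suc (stage (hist j))) \<le> offset (hist j)")
        case True
        then show ?thesis by (simp add: hist_Suc)
      next
        case not_le: False
        then show ?thesis using Suc.IH False by (simp add: hist_Suc)
      qed
      with N[OF _ y] have "\<exists>y. candidate U X (hist (Suc j)) y" by (simp only: hist_Suc)
      then show ?thesis using N_le le by simp
    qed
  qed
  then obtain ys where ys: "\<And>j. candidate U X (hist j) (ys j)" by metis
  have length_ys: "length (ys j) = offset (hist j)" for j using ys[of j] by (simp add: candidate_def)

  have stage_unbounded: "\<exists>j. K \<le> stage (hist j)" for K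
  proof (induction K)
    case (Suc K)
    then obtain j where j: "K \<le> stage (hist j)" by blast
    define i where "i = max j (N (Suc K))"
    have iK: "K \<le> stage (hist i)" using j stage_mono[of j i] by (simp add: i_def)
    have "Suc K \<le> stage (hist (Suc i))"
    proof (cases "stage (hist i) = K")
      case True
      have "N (Suc K) \<le> offset (hist i)" using le_offset[of i] by (simp add: i_def)
      then show ?thesis using True by (simp add: hist_Suc)
    next
      case False
      then show ?thesis using iK by (simp add: hist_Suc)
    qed
    then show ?case by blast
  qed simp

  obtain Y where Y: "\<And>n. infinite {j. take n (ys j) = seq_prefix Y n}"
    using koenig[of ys] le_offset length_ys by metis
  have ex: "\<exists>j\<ge>i. take n (ys j) = seq_prefix Y n" for n i
    using Y[of n] unfolding infinite_nat_iff_unbounded_le by blast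

  have "martin_loef_random U Y"
    unfolding martin_loef_random_def
  proof (intro exI[of _ 0] allI)
    fix n
    obtain j where "take n (ys j) = seq_prefix Y n" using ex[of 0 n] by blast
    hence "prefix (seq_prefix Y n) (ys j)" using take_is_prefix by metis
    moreover have "\<not> compressible U (ys j)"
      using ys[of j] good_imp_not_compressible by (auto simp: candidate_def)
    ultimately show "enat n \<le> complexity U (seq_prefix Y n) + enat 0"
      using complexity_ge_if_not_compressible[of U "ys j" "seq_prefix Y n"] by (simp flip: zero_enat_def)
  qed

  let ?D = "\<lambda>n. mism (seq_prefix X n) (seq_prefix Y n)"
  have close: "close (hist j) (seq_prefix X (offset (hist j))) (seq_prefix Y (offset (hist j)))" for j
  proof -
    let ?n = "offset (hist j)"
    obtain i where i: "i \<ge> j" "take ?n (ys i) = seq_prefix Y ?n" using ex[of j ?n] by blast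
    have "close (hist i) (seq_prefix X (offset (hist i))) (ys i)" using ys[of i] by (simp add: candidate_def)
    from close_drop[OF this, of "i - j"]
    have "close (hist j) (seq_prefix X (offset (hist i))) (ys i)" using drop_hist[of "i - j" j] i(1) by simp
    hence "close (hist j) (take ?n (seq_prefix X (offset (hist i)))) (take ?n (ys i))"
      by (simp only: close_take[OF order_refl order_refl])
    thus ?thesis using i(2) offset_mono[OF i(1)] by (simp add: min_absorb1)
  qed
  have D_Suc: "stage (hist (Suc j)) * ?D (offset (hist (Suc j))) \<le>
      stage (hist (Suc j)) * ?D (offset (hist j)) + block_length (hist (Suc j))" for j
  proof -
    let ?h = "hist (Suc j)"
    obtain b where b: "?h = b # hist j" by (simp add: hist_Suc)
    have off: "offset ?h = offset (hist j) + block_length ?h" unfolding b by (rule offset_Cons)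
    have blk: "block ?h (seq_prefix Z (offset ?h)) = drop (offset (hist j)) (seq_prefix Z (offset ?h))" for Z
      unfolding block_def by (simp add: b del: offset.simps)
    have "stage ?h * mism (block ?h (seq_prefix X (offset ?h))) (block ?h (seq_prefix Y (offset ?h))) \<le> block_length ?h"
      using close[of "Suc j"] unfolding b close_Cons by blast
    moreover have "?D (offset ?h) = ?D (offset (hist j)) + mism (block ?h (seq_prefix X (offset ?h))) (block ?h (seq_prefix Y (offset ?h)))"
      unfolding blk unfolding off by (rule mism_seq_prefix_add)
    ultimately show ?thesis by (simp add: distrib_left)
  qed
  \<comment> \<open>the mismatches before block \<open>J\<close> are bounded trivially, those in the later blocks by a fraction \<open>1/K\<close>\<close>
  have D_block: "K * ?D (offset (hist j)) \<le> K * offset (hist J) + offset (hist j)"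
    if J: "K \<le> stage (hist J)" "J \<le> j" for K J j
    using J(2)
  proof (induction j rule: dec_induct)
    case base
    have "?D (offset (hist J)) \<le> offset (hist J)" using mism_le by (metis length_seq_prefix)
    thus ?case by (simp add: trans_le_add1)
  next
    case (step j)
    let ?s = "stage (hist (Suc j))"
    have Ks: "K \<le> ?s" using J(1) stage_mono[of J "Suc j"] step(1) by simp
    define d where "d = ?D (offset (hist (Suc j))) - ?D (offset (hist j))"
    have off: "offset (hist (Suc j)) = offset (hist j) + block_length (hist (Suc j))"
      unfolding hist_Suc by (rule offset_Cons)
    have "?s * d \<le> block_length (hist (Suc j))"
      using D_Suc[of j] by (simp add: d_def diff_mult_distrib2)
    hence "K * d \<le> block_length (hist (Suc j))" using Ks mult_le_mono1 order_trans by blast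
    moreover have "K * ?D (offset (hist (Suc j))) \<le> K * ?D (offset (hist j)) + K * d"
      unfolding d_def distrib_left[symmetric] by (rule mult_le_mono2) linarith
    ultimately show ?case using step.IH off by linarith
  qed
  have "seq_dist X Y = 0"
    unfolding seq_dist_eq_0_iff
  proof (intro allI impI)
    fix \<epsilon> :: real assume \<epsilon>: "\<epsilon> > 0"
    obtain K0 :: nat where K0: "4 / \<epsilon> \<le> real K0" using real_arch_simple by blast
    define K where "K = Suc K0"
    have K: "K \<ge> 1" "2 / real K \<le> \<epsilon> / 2" using K0 \<epsilon> by (auto simp: K_def field_simps)
    obtain J where J: "K \<le> stage (hist J)" using stage_unbounded by blast
    define m where "m = offset (hist J)"
    have "\<forall>\<^sub>F n in sequentially. (real m + 1) + 2 * sqrt (real n) \<le> \<epsilon> / 2 * real n"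
      using \<epsilon> by (intro eventually_sqrt_le_linear) simp
    thus "\<forall>\<^sub>F n in sequentially. real (?D n) \<le> \<epsilon> * real n"
      using eventually_ge_at_top[of m]
    proof eventually_elim
      case (elim n)
      \<comment> \<open>\<open>n\<close> lies in block \<open>i\<close>; within this block all positions are counted as mismatches\<close>
      define i where "i = (LEAST i. n < offset (hist i))"
      have i: "n < offset (hist i)" unfolding i_def
        by (rule LeastI[of _ "Suc n"]) (use le_offset[of "Suc n"] in simp)
      have "J < i"
      proof (rule ccontr)
        assume "\<not> J < i"
        hence "offset (hist i) \<le> m" unfolding m_def by (intro offset_mono) simp
        thus False using i elim(2) by simp
      qed
      then obtain j where j: "i = Suc j" "J \<le> j" by (metis less_Suc_eq_le not0_implies_Suc not_less_zero)
      have jn: "offset (hist j) \<le> n"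
        using not_less_Least[of j "\<lambda>i. n < offset (hist i)"] j(1) by (simp add: i_def not_less)
      define d where "d = n - offset (hist j)"
      have n: "n = offset (hist j) + d" using jn by (simp add: d_def)
      have d: "d \<le> block_length (hist (Suc j))"
        using i jn unfolding d_def j(1) block_length_def by (simp add: hist_Suc)
      have "stage (hist (Suc j)) \<ge> K" using J stage_mono[of J "Suc j"] j(2) by simp
      hence "offset (hist j) div stage (hist (Suc j)) \<le> offset (hist j) div K"
        using K(1) by (intro div_le_mono2) auto
      also have "\<dots> \<le> n div K" by (rule div_le_mono[OF jn])
      finally have d_le: "d \<le> n div K + 2 * j + 1"
        using d length_hist[of j] unfolding hist_Suc block_length_Cons by simp
      have "K * ?D (offset (hist j)) \<le> K * m + n"
        using D_block[OF J j(2)] jn unfolding m_def by simp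
      hence "real (K * ?D (offset (hist j))) \<le> real (K * m + n)" by (simp only: of_nat_le_iff)
      hence D_le: "real (?D (offset (hist j))) \<le> real m + real n / real K"
        using K(1) by (simp add: field_simps)
      have "?D n \<le> ?D (offset (hist j)) + d"
        unfolding n mism_seq_prefix_add by (intro add_left_mono order_trans[OF mism_le]) simp
      hence "real (?D n) \<le> real (?D (offset (hist j))) + real d" by linarith
      also have "real d \<le> real n / real K + 2 * real j + 1"
      proof -
        have "real (n div K) \<le> real n / real K" by (rule of_nat_div_le_of_nat)
        thus ?thesis using d_le by linarith
      qed
      also have "real j \<le> sqrt (real n)"
      proof (rule real_le_rsqrt)
        have "j * j \<le> n" using length_square_le_offset[of "hist j"] length_hist jn by simp
        hence "real (j * j) \<le> real n" by (simp only: of_nat_le_iff)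
        thus "(real j)\<^sup>2 \<le> real n" by (simp add: power2_eq_square)
      qed
      finally have "real (?D n) \<le> (real m + 1 + 2 * sqrt (real n)) + 2 / real K * real n"
        using D_le by simp
      also have "2 / real K * real n \<le> \<epsilon> / 2 * real n" using K(2) by (intro mult_right_mono) auto
      finally show ?case using elim(1) by simp
    qed
  qed
  with \<open>martin_loef_random U Y\<close> show ?thesis by blast
qed

theorem theorem1p7:
  fixes U :: "bool list \<rightharpoonup> bool list" and X :: "nat \<Rightarrow> bool"
  assumes "optimal_prefix_free_machine U"
  shows "effective_dim U X = 1 \<longleftrightarrow> (\<exists>Y. martin_loef_random U Y \<and> seq_dist X Y = 0)"
  using ex_close_random_if_effective_dim_eq_1[OF assms] effective_dim_eq_1_if_close_to_random[OF assms]
  by blast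

end
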